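(* Let $\Omega\subset\mathbb R^n$ be open, let $F:\Omega\to\mathbb R^m$ be locally Lipschitz continuous, and let $x\in\Omega$. Then, for any $\mathcal L^n$-null set $N\subset\Omega$, $$\partial F(x)=\operatorname{conv}\Big\{\lim_{j\to\infty}DF(x_j)\ \Big|\ x_j\to x,\ x_j\in D_F\setminus N\Big\}=\big\{\mathsf F\in\mathbb R^{m\times n}\ \big|\ \mathsf F:\mathsf V\le F^\circ(x;\mathsf V)\text{ for all }\mathsf V\in\mathbb R^{m\times n}\big\},$$ where in the first set all sequences $(x_j)$ for which the limit exists are considered.
   Context: $\mathcal L^n$ is Lebesgue measure, $\mathcal B(\Omega)$ the Borel subsets of $\Omega$, $\operatorname{conv}$ the convex hull, $\mathsf F:\mathsf V$ the Euclidean scalar product of matrices. $D_F$ is the set of points of $\Omega$ where $F$ is differentiable; by Rademacher's theorem $\mathcal L^n(\Omega\setminus D_F)=0$, and $DF$ is locally essentially bounded. $\mathrm{ba}(\Omega,\mathcal B(\Omega),\mathcal L^n)$ is the space of bounded finitely additive set functions $\mu:\mathcal B(\Omega)\to\mathbb R$ with $\mu(A)=0$ whenever $\mathcal L^n(A)=0$. For $x\in\Omega$, $\mathrm{Dens}_x$ is the set of all such $\mu$ with $\mu\ge0$ and $\mu(B_\delta(x)\cap\Omega)=\mu(\Omega)=1$ for all $\delta>0$. For a bounded measurable function the integral $\int d\mu$ is defined by uniform approximation with Borel step functions; for a function $g$ that is essentially bounded on $B_\delta(x)$, $\int_\Omega g\,d\mu:=\int_{B_\delta(x)}g\,d\mu$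 for $\mu\in\mathrm{Dens}_x$ (independent of small $\delta$); matrix functions are treated componentwise. The generalized derivative of $F$ at $x$ is $$\partial F(x):=\langle\mathrm{Dens}_x,DF\rangle:=\Big\{\int_\Omega DF\,d\mu\ \Big|\ \mu\in\mathrm{Dens}_x\Big\}\subset\mathbb R^{m\times n},$$ and $F^\circ(x;\mathsf V):=\max_{\mathsf F\in\partial F(x)}\mathsf F:\mathsf V$ for $\mathsf V\in\mathbb R^{m\times n}$ is its support function ($\partial F(x)$ is compact and convex). *)

theory Defs
  imports "HOL-Analysis.Analysis"
begin

definition locally_lipschitz_on ::
  "'a::metric_space set \<Rightarrow> ('a \<Rightarrow> 'b::metric_space) \<Rightarrow> bool" where
  "locally_lipschitz_on \<Omega> F \<longleftrightarrow>
     (\<forall>y\<in>\<Omega>. \<exists>r>0. \<exists>L. L-lipschitz_on (ball y r \<inter> \<Omega>) F)"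

definition diff_points ::
  "(real^'n) set \<Rightarrow> (real^'n \<Rightarrow> real^'m) \<Rightarrow> (real^'n) set" where
  "diff_points \<Omega> F = {y \<in> \<Omega>. F differentiable (at y)}"

text \<open>
  \<open>DF(y)\<close> is \<open>jacobian F (at y)\<close>, of type \<open>real^'n^'m\<close>, which is meaningful on
  \<^const>\<open>diff_points\<close>. The inner product of that type is the Euclidean scalar
  product of matrices.
\<close>

definition borel_subsets :: "'a::topological_space set \<Rightarrow> 'a set set" where
  "borel_subsets \<Omega> = {A \<in> sets borel. A \<subseteq> \<Omega>}"

text \<open>
  Set functions are total on \<open>'a set\<close>; only their values on \<open>borel_subsets \<Omega>\<close>
  are constrained, and only these enter the integrals below.
\<close>
definition ba :: "'a::euclidean_space set \<Rightarrow> ('a set \<Rightarrow> real) set" where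
  "ba \<Omega> = {\<mu>.
     (\<exists>C. \<forall>A\<in>borel_subsets \<Omega>. \<bar>\<mu> A\<bar> \<le> C) \<and>
     (\<forall>A\<in>borel_subsets \<Omega>. \<forall>B\<in>borel_subsets \<Omega>.
        A \<inter> B = {} \<longrightarrow> \<mu> (A \<union> B) = \<mu> A + \<mu> B) \<and>
     (\<forall>A\<in>borel_subsets \<Omega>. emeasure lborel A = 0 \<longrightarrow> \<mu> A = 0)}"

definition Dens :: "'a::euclidean_space set \<Rightarrow> 'a \<Rightarrow> ('a set \<Rightarrow> real) set" where
  "Dens \<Omega> x = {\<mu> \<in> ba \<Omega>.
     (\<forall>A\<in>borel_subsets \<Omega>. 0 \<le> \<mu> A) \<and>
     \<mu> \<Omega> = 1 \<and> (\<forall>\<delta>>0. \<mu> (ball x \<delta> \<inter> \<Omega>) = 1)}"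

definition step_integral ::
  "('a set \<Rightarrow> real) \<Rightarrow> 'a set \<Rightarrow> ('a \<Rightarrow> real) \<Rightarrow> real" where
  "step_integral \<mu> A s = (\<Sum>c\<in>s ` A. c * \<mu> (s -` {c} \<inter> A))"

text \<open>
  Uniform approximation of \<open>g\<close> on \<open>A\<close> by Borel step functions. Integrands are only
  essentially bounded (and, like \<open>DF\<close>, only defined almost everywhere), so a
  Lebesgue null set \<open>Z\<close> is disregarded; such sets are not seen by \<open>\<mu> \<in> ba \<Omega>\<close>.
\<close>
definition has_ba_integral ::
  "('a::euclidean_space set \<Rightarrow> real) \<Rightarrow> 'a set \<Rightarrow> ('a \<Rightarrow> real) \<Rightarrow> real \<Rightarrow> bool" where
  "has_ba_integral \<mu> A g I \<longleftrightarrow>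
     (\<exists>s Z. Z \<in> null_sets lebesgue \<and>
        (\<forall>k::nat. simple_function borel (s k)) \<and>
        uniform_limit (A - Z) s g sequentially \<and>
        (\<lambda>k. step_integral \<mu> A (s k)) \<longlonglongrightarrow> I)"

text \<open>
  The integral over \<open>\<Omega>\<close> with respect to \<open>\<mu> \<in> Dens \<Omega> x\<close> of a function that is
  essentially bounded near \<open>x\<close>: its integral over any small ball around \<open>x\<close>. The
  value does not depend on the radius because \<open>\<mu>\<close> vanishes on \<open>\<Omega>\<close> minus any such ball.
\<close>
definition dens_integral ::
  "'a::euclidean_space set \<Rightarrow> 'a \<Rightarrow> ('a set \<Rightarrow> real) \<Rightarrow> ('a \<Rightarrow> real) \<Rightarrow> real" where
  "dens_integral \<Omega> x \<mu> g =
     (THE I. \<exists>\<delta>>0. ball x \<delta> \<subseteq> \<Omega> \<and> has_ba_integral \<mu> (ball x \<delta>) g I)"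

definition gen_derivative ::
  "(real^'n) set \<Rightarrow> (real^'n \<Rightarrow> real^'m) \<Rightarrow> real^'n \<Rightarrow> (real^'n^'m) set" where
  "gen_derivative \<Omega> F x =
     {(\<chi> i j. dens_integral \<Omega> x \<mu> (\<lambda>y. jacobian F (at y) $ i $ j)) | \<mu>. \<mu> \<in> Dens \<Omega> x}"

text \<open>\<open>GREATEST\<close> is the maximum, so a value is specified only if it is attained.\<close>
definition gen_dir_derivative ::
  "(real^'n) set \<Rightarrow> (real^'n \<Rightarrow> real^'m) \<Rightarrow> real^'n \<Rightarrow> real^'n^'m \<Rightarrow> real" where
  "gen_dir_derivative \<Omega> F x V =
     (GREATEST r. r \<in> (\<lambda>A. A \<bullet> V) ` gen_derivative \<Omega> F x)"

end

theory Submission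
  imports Defs
begin

text \<open>
  The inclusion of the hull in the generalized derivative rests on a property of points of
  differentiability: at every such point \<open>y\<close> the means of \<open>DF\<close> over small cubes centred at \<open>y\<close>
  converge to \<open>DF y\<close>. Indeed, by dominated convergence the integral of a partial derivative
  over a cube is the limit of integrals of difference quotients, which reduce to the integral
  of the function over the symmetric difference of two translated cubes; subtracting the
  affine approximation at \<open>y\<close> makes this small. Hence a limit of \<open>DF (x\<^sub>j)\<close> is a limit of means
  of \<open>DF\<close> over cubes shrinking to \<open>x\<close>, and a cluster point of the normalised Lebesgue measures
  on these cubes is an element of \<open>Dens\<close> that represents it.

  Conversely, if a point of the generalized derivative lay outside the hull, which is compact,
  a hyperplane would separate them. Since \<open>DF\<close> is locally bounded, \<open>DF\<close> would then lie on the
  far side of the hyperplane at almost all points near \<open>x\<close>, and so would its integrals.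

  Both directions need Rademacher's theorem. In dimension one it follows from the Vitali
  covering theorem applied to Stieltjes measures; Fubini's theorem then gives the partial
  derivatives almost everywhere, and these make up a total derivative at almost every point,
  because the set of points of a closed set at which the set is porous is negligible.
\<close>

section \<open>Almost everywhere existence of directional derivatives\<close>

text \<open>The obstacle is that \<open>N\<close> is arbitrary. Separation puts the generalized
  derivative inside the hull for every null set \<open>N\<close>, however many points it removes, so
  the reverse inclusion has to cope with every point of differentiability. Were the convergence of
  means known only at almost every point, say at Lebesgue points of DF, a limit along exceptional
  points might leave the generalized derivative, and the hull might depend on \<open>N\<close>. This
  is why the estimate is made at each single point: for a fixed cube the step of the difference
  quotients tends to 0 first, and only then does the cube shrink. A second difficulty is that DF is
  meaningful only on \<open>diff_points\<close>. Integrals are therefore computed with a bounded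
  Borel function that agrees with DF almost everywhere near \<open>x\<close>. Rademacher's theorem
  supplies the agreement and also guarantees that there are limits of DF at all. It is proved for
  functions that are Lipschitz on the whole space and reaches \<open>F\<close> through the
  projection onto a closed ball around \<open>x\<close>.\<close>

text \<open>Take the small balls inside an open \<open>U\<close> that barely exceeds
  \<open>A\<close>. A disjoint countable subfamily covers \<open>A\<close> up to a null set, and
  summing the bound over it gives at most \<open>p\<close> times the measure of \<open>U\<close>.
  The balls need not be centred at \<open>x\<close>, because the intervals used later have
  \<open>x\<close> as an end point.\<close>

lemma emeasure_le_Vitali:
  fixes A :: "'a::euclidean_space set" and p :: real
  assumes sM [measurable_cong]: "sets M = sets borel"
    and ac: "null_sets lborel \<subseteq> null_sets M"
    and A [measurable]: "A \<in> sets borel"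
    and p: "0 \<le> p"
    and cov: "\<And>x d. x \<in> A \<Longrightarrow> d > 0 \<Longrightarrow> \<exists>c r. 0 < r \<and> r < d \<and> x \<in> cball c r \<and>
                emeasure M (cball c r) \<le> p * emeasure lborel (cball c r)"
  shows "emeasure M A \<le> p * emeasure lborel A"
proof (rule ennreal_le_epsilon)
  fix e :: real assume e: "0 < e"
  \<comment> \<open>The \<open>+ 1\<close> keeps the quotient defined for
    \<open>p = 0\<close>.\<close>
  define e' where "e' = e / (p + 1)"
  have e': "0 < e'" "p * e' \<le> e"
    using e p by (auto simp: e'_def field_simps)
  obtain U where U: "open U" "A \<subseteq> U" "emeasure lebesgue (U - A) < ennreal e'"
    using sets_lebesgue_outer_open[of A e'] A e' by auto
  have [measurable]: "U \<in> sets borel" using U by simp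
  define K where "K = {i::'a \<times> real. 0 < snd i \<and> cball (fst i) (snd i) \<subseteq> U \<and>
     emeasure M (cball (fst i) (snd i)) \<le> p * emeasure lborel (cball (fst i) (snd i))}"
  obtain C where C: "countable C" "C \<subseteq> K"
     "pairwise (\<lambda>i j. disjnt (cball (fst i) (snd i)) (cball (fst j) (snd j))) C"
     "negligible (A - (\<Union>i \<in> C. cball (fst i) (snd i)))"
  proof (rule Vitali_covering_theorem_cballs[of K snd A fst])
    show "\<And>i. i \<in> K \<Longrightarrow> 0 < snd i" by (auto simp: K_def)
  next
    fix x and d :: real assume x: "x \<in> A" "0 < d"
    then obtain s where s: "s > 0" "ball x s \<subseteq> U" using U by (meson openE subsetD)
    \<comment> \<open>Half of \<open>s\<close>, since \<open>x\<close> may lie on the boundary of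
      the ball, whose points are then up to \<open>2 * r\<close> away from \<open>x\<close>.\<close>
    obtain c r where cr: "0 < r" "r < min d (s/2)" "x \<in> cball c r"
         "emeasure M (cball c r) \<le> p * emeasure lborel (cball c r)"
      using cov[OF x(1), of "min d (s/2)"] x s by auto
    have "cball c r \<subseteq> ball x s"
    proof
      fix y assume "y \<in> cball c r"
      then have "dist x y \<le> 2 * r" using cr dist_triangle[of x y c] by (auto simp: dist_commute)
      then show "y \<in> ball x s" using cr by auto
    qed
    then show "\<exists>i. i \<in> K \<and> x \<in> cball (fst i) (snd i) \<and> snd i < d"
      using cr s by (intro exI[of _ "(c, r)"]) (auto simp: K_def)
  qed
  let ?V = "\<Union>i \<in> C. cball (fst i) (snd i)"
  have disj: "disjoint_family_on (\<lambda>i. cball (fst i) (snd i)) C"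
    using C(3) by (auto simp: pairwise_def disjnt_def disjoint_family_on_def)
  have [measurable]: "?V \<in> sets borel"
    using C(1) by (intro sets.countable_UN') auto
  \<comment> \<open>The covering theorem leaves a Lebesgue null set uncovered; absolute continuity
    makes it null for \<open>M\<close> too.\<close>
  have null: "A - ?V \<in> null_sets M"
  proof -
    have "A - ?V \<in> null_sets lebesgue" using C(4) negligible_iff_null_sets by blast
    moreover have "A - ?V \<in> sets lborel" by simp
    ultimately show ?thesis using ac null_sets_completion_iff[of "A - ?V" lborel] by blast
  qed
  have "emeasure M A \<le> emeasure M (?V \<union> (A - ?V))"
    by (rule emeasure_mono) auto
  also have "\<dots> = emeasure M ?V"
    using null by (intro emeasure_Un_null_set) auto
  also have "\<dots> = (\<integral>\<^sup>+i. emeasure M (cball (fst i) (snd i)) \<partial>count_space C)"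
    using C(1) disj by (intro emeasure_UN_countable) (auto simp: sM)
  also have "\<dots> \<le> (\<integral>\<^sup>+i. p * emeasure lborel (cball (fst i) (snd i)) \<partial>count_space C)"
    using C(2) by (intro nn_integral_mono) (auto simp: K_def)
  also have "\<dots> = p * (\<integral>\<^sup>+i. emeasure lborel (cball (fst i) (snd i)) \<partial>count_space C)"
    by (intro nn_integral_cmult) auto
  also have "(\<integral>\<^sup>+i. emeasure lborel (cball (fst i) (snd i)) \<partial>count_space C) = emeasure lborel ?V"
    using C(1) disj by (intro emeasure_UN_countable[symmetric]) auto
  also have "p * emeasure lborel ?V \<le> p * emeasure lborel (A \<union> (U - A))"
    using C(2) U(2) by (intro mult_left_mono emeasure_mono) (auto simp: K_def)
  also have "\<dots> \<le> p * (emeasure lborel A + ennreal e')"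
  proof -
    have "emeasure lborel (A \<union> (U - A)) \<le> emeasure lborel A + emeasure lborel (U - A)"
      by (rule emeasure_subadditive) auto
    also have "emeasure lborel (U - A) = emeasure lebesgue (U - A)" by simp
    also have "emeasure lborel A + \<dots> \<le> emeasure lborel A + ennreal e'"
      using U(3) by (intro add_left_mono) auto
    finally show ?thesis by (rule mult_left_mono) auto
  qed
  also have "\<dots> = p * emeasure lborel A + ennreal (p * e')"
    using p e' by (simp add: distrib_left ennreal_mult)
  also have "\<dots> \<le> p * emeasure lborel A + ennreal e"
    using e' by (intro add_left_mono ennreal_leI)
  finally show "emeasure M A \<le> p * emeasure lborel A + ennreal e" .
qed

text \<open>Over every interval the increments of \<open>g\<close> and of \<open>x - g x\<close> add
  up to the length, and \<open>lborel\<close> is determined by its values on boxes. The sum is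
  packaged as a measure \<open>M\<close> so that this uniqueness applies.\<close>

lemma emeasure_interval_measure_add_complement:
  fixes g :: "real \<Rightarrow> real"
  assumes mono: "\<And>x y. x \<le> y \<Longrightarrow> g x \<le> g y"
    and mono': "\<And>x y. x \<le> y \<Longrightarrow> x - g x \<le> y - g y"
    and cont: "continuous_on UNIV g"
    and A: "A \<in> sets borel"
  shows "emeasure (interval_measure g) A + emeasure (interval_measure (\<lambda>x. x - g x)) A = emeasure lborel A"
proof -
  define m where "m A = emeasure (interval_measure g) A + emeasure (interval_measure (\<lambda>x. x - g x)) A" for A
  define M where "M = measure_of UNIV (sets borel) m"
  have cont': "continuous_on UNIV (\<lambda>x. x - g x)" by (intro continuous_intros cont)
  have sM: "sets M = sets borel"
    unfolding M_def using sets.sigma_sets_eq[of borel] by (simp add: sets_measure_of_conv)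
  have em: "emeasure M B = m B" if "B \<in> sets borel" for B
  proof (rule emeasure_measure_of[OF M_def])
    show "sets borel \<subseteq> Pow (UNIV :: real set)" by simp
    show "B \<in> sets M" using that sM by simp
    show "positive (sets M) m" by (simp add: positive_def m_def)
    show "countably_additive (sets M) m"
      unfolding countably_additive_def sM m_def
      by (simp add: suminf_add[symmetric] suminf_emeasure)
  qed
  \<comment> \<open>The uniqueness criterion for \<open>lborel\<close> speaks of open boxes; by
    continuity the end points carry no mass.\<close>
  have Ioo: "emeasure (interval_measure h) {l<..<u} = ennreal (h u - h l)"
    if lu: "l \<le> u" and h: "\<And>x y. x \<le> y \<Longrightarrow> h x \<le> h y" "continuous_on UNIV h" for h :: "real \<Rightarrow> real" and l u
  proof (cases "l = u")
    case False
    have "emeasure (interval_measure h) ({l..u} - {l,u}) = emeasure (interval_measure h) {l..u}"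
    proof (rule emeasure_Diff_null_set)
      have "emeasure (interval_measure h) {a} = 0" for a
        using emeasure_interval_measure_Icc[OF order_refl h, of a] by simp
      then have "{l} \<union> {u} \<in> null_sets (interval_measure h)"
        by (intro null_sets.Un) (auto simp: null_sets_def)
      then show "{l,u} \<in> null_sets (interval_measure h)" by (simp add: insert_commute)
    qed auto
    moreover have "{l..u} - {l,u} = {l<..<u}" by auto
    ultimately show ?thesis using emeasure_interval_measure_Icc[OF lu h] by simp
  qed auto
  have "lborel = M"
  proof (rule lborel_eqI)
    fix l u :: real assume "\<And>b. b \<in> Basis \<Longrightarrow> l \<bullet> b \<le> u \<bullet> b"
    then have lu: "l \<le> u" by simp
    have "m {l<..<u} = ennreal (g u - g l) + ennreal ((u - g u) - (l - g l))"
      using Ioo[OF lu mono cont] Ioo[OF lu mono' cont'] by (simp add: m_def)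
    also have "\<dots> = ennreal (u - l)"
      using mono[OF lu] mono'[OF lu] by (subst ennreal_plus[symmetric]) auto
    finally show "emeasure M (box l u) = (\<Prod>b\<in>Basis. (u - l) \<bullet> b)"
      by (simp add: em)
  qed (rule sM)
  then have "emeasure lborel A = m A" using em[OF A] by simp
  then show ?thesis by (simp add: m_def)
qed

text \<open>Contains every point where the lower limit of the difference quotients along
  \<open>u\<close> is below \<open>p\<close> and the upper limit is above \<open>q\<close>. For
  continuous \<open>f\<close> the strict inequalities are open conditions on \<open>y\<close> for
  each \<open>h\<close>, so the set is Borel although \<open>h\<close> ranges over an uncountable
  set.\<close>

definition osc_set :: "('a::real_normed_vector \<Rightarrow> real) \<Rightarrow> 'a \<Rightarrow> real \<Rightarrow> real \<Rightarrow> 'a set" where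
  "osc_set f u p q = {y. \<forall>k::nat.
     (\<exists>h. 0 < \<bar>h\<bar> \<and> \<bar>h\<bar> < 1 / Suc k \<and> (f (y + h *\<^sub>R u) - f y) / h < p) \<and>
     (\<exists>h. 0 < \<bar>h\<bar> \<and> \<bar>h\<bar> < 1 / Suc k \<and> q < (f (y + h *\<^sub>R u) - f y) / h)}"

lemma osc_set_borel:
  fixes f :: "'a::real_normed_vector \<Rightarrow> real"
  assumes "continuous_on UNIV f"
  shows "osc_set f u p q \<in> sets borel"
proof -
  have cont: "continuous_on UNIV (\<lambda>y. (f (y + h *\<^sub>R u) - f y) / h)" if "0 < \<bar>h\<bar>" for h
    using that by (intro continuous_intros continuous_on_compose2[OF assms]) auto
  have "osc_set f u p q = (\<Inter>k::nat.
      (\<Union>h\<in>{h. 0 < \<bar>h\<bar> \<and> \<bar>h\<bar> < 1 / Suc k}. {y. (f (y + h *\<^sub>R u) - f y) / h < p}) \<inter>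
      (\<Union>h\<in>{h. 0 < \<bar>h\<bar> \<and> \<bar>h\<bar> < 1 / Suc k}. {y. q < (f (y + h *\<^sub>R u) - f y) / h}))"
    by (auto simp: osc_set_def)
  also have "\<dots> \<in> sets borel"
    by (intro sets.countable_INT'' sets.Int borel_open open_UN ballI UNIV_I
        open_Collect_less continuous_on_const cont) auto
  finally show ?thesis .
qed

text \<open>For \<open>h\<close> of either sign, the quotient at \<open>x\<close> is the increment
  over the interval between \<open>x\<close> and \<open>x + h\<close> divided by its length. This
  interval is the ball with centre \<open>x + h/2\<close> and radius
  \<open>\<bar>h\<bar>/2\<close>.\<close>

lemma osc_set_cover:
  fixes g :: "real \<Rightarrow> real"
  assumes "x \<in> osc_set g 1 p q" "0 < d"
  obtains c r c' r' where "0 < r" "r < d" "x \<in> cball c r" "g (c + r) - g (c - r) \<le> p * (2 * r)"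
    "0 < r'" "r' < d" "x \<in> cball c' r'" "q * (2 * r') \<le> g (c' + r') - g (c' - r')"
proof -
  obtain k where k: "1 / real (Suc k) < d" using assms(2) nat_approx_posE by blast
  have *: "\<exists>c r. 0 < r \<and> r < d \<and> x \<in> cball c r \<and> (g (c + r) - g (c - r)) / (2 * r) = (g (x + h) - g x) / h"
    if "0 < \<bar>h\<bar>" "\<bar>h\<bar> < 1 / Suc k" for h
  proof (rule exI[of _ "x + h/2"], rule exI[of _ "\<bar>h\<bar>/2"], intro conjI)
    show "(g (x + h / 2 + \<bar>h\<bar> / 2) - g (x + h / 2 - \<bar>h\<bar> / 2)) / (2 * (\<bar>h\<bar> / 2)) = (g (x + h) - g x) / h"
    proof (cases "h > 0")
      case True
      then have "x + h / 2 + \<bar>h\<bar> / 2 = x + h" "x + h / 2 - \<bar>h\<bar> / 2 = x" by auto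
      with True show ?thesis by (simp add: add.commute)
    next
      case False
      then have "x + h / 2 + \<bar>h\<bar> / 2 = x" "x + h / 2 - \<bar>h\<bar> / 2 = x + h" "\<bar>h\<bar> = - h" by auto
      then show ?thesis using minus_divide_divide[of "g (x + h) - g x" h] by (simp add: add.commute)
    qed
  qed (use that k in \<open>auto simp: dist_real_def\<close>)
  obtain h where h: "0 < \<bar>h\<bar>" "\<bar>h\<bar> < 1 / Suc k" "(g (x + h) - g x) / h < p"
    using assms(1) by (auto simp: osc_set_def)
  obtain h' where h': "0 < \<bar>h'\<bar>" "\<bar>h'\<bar> < 1 / Suc k" "q < (g (x + h') - g x) / h'"
    using assms(1) by (auto simp: osc_set_def)
  obtain c r where cr: "0 < r" "r < d" "x \<in> cball c r" "(g (c + r) - g (c - r)) / (2 * r) < p"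
    using *[OF h(1,2)] h(3) by auto
  obtain c' r' where cr': "0 < r'" "r' < d" "x \<in> cball c' r'" "q < (g (c' + r') - g (c' - r')) / (2 * r')"
    using *[OF h'(1,2)] h'(3) by auto
  show thesis
    by (rule that[OF cr(1-3) _ cr'(1-3)]) (use cr cr' in \<open>auto simp: field_simps\<close>)
qed

text \<open>
  On the set in question the Stieltjes measures of \<open>g\<close> and \<open>x - g x\<close>, which add up to
  Lebesgue measure, are at most \<open>p\<close> and \<open>1 - q\<close> times Lebesgue measure.
\<close>
lemma osc_set_null_monotone:
  fixes g :: "real \<Rightarrow> real"
  assumes mono: "\<And>x y. x \<le> y \<Longrightarrow> g x \<le> g y"
    and mono': "\<And>x y. x \<le> y \<Longrightarrow> x - g x \<le> y - g y"
    and cont: "continuous_on UNIV g"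
    and pq: "p < q"
  shows "osc_set g 1 p q \<in> null_sets lborel"
proof -
  have B [measurable]: "osc_set g 1 p q \<in> sets borel" using cont by (rule osc_set_borel)
  have cont': "continuous_on UNIV (\<lambda>x. x - g x)" by (intro continuous_intros cont)
  have add: "emeasure (interval_measure g) A + emeasure (interval_measure (\<lambda>x. x - g x)) A = emeasure lborel A"
    if "A \<in> sets borel" for A
    by (rule emeasure_interval_measure_add_complement) (use mono mono' cont that in auto)
  have cball: "cball c r = {c - r..c + r}" for c r :: real by (rule cball_eq_atLeastAtMost)
  \<comment> \<open>Cutting off at \<open>R\<close> makes the measure finite, so that the final
    inequality can be solved for it.\<close>
  have "emeasure lborel (osc_set g 1 p q \<inter> {-R..R}) = 0" (is "emeasure _ ?A = 0") for R
  proof (cases "?A = {}")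
    case False
    \<comment> \<open>One point of the set already forces \<open>0 \<le> p\<close> and
      \<open>q \<le> 1\<close>, since neither \<open>g\<close> nor \<open>x - g x\<close> decreases.
      These signs are needed for the factors \<open>p\<close> and \<open>1 - q\<close>.\<close>
    then obtain x where x: "x \<in> osc_set g 1 p q" by auto
    obtain c r c' r' where "0 < r" "x \<in> cball c r" "g (c + r) - g (c - r) \<le> p * (2 * r)"
      "0 < r'" "x \<in> cball c' r'" "q * (2 * r') \<le> g (c' + r') - g (c' - r')"
      by (rule osc_set_cover[OF x zero_less_one])
    then have "0 \<le> p * (2 * r)" "0 \<le> (1 - q) * (2 * r')"
      using mono[of "c - r" "c + r"] mono'[of "c' - r'" "c' + r'"] unfolding left_diff_distrib by linarith+
    with \<open>0 < r\<close> \<open>0 < r'\<close> have pq01: "0 \<le> p" "q \<le> 1"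
      by (auto simp: zero_le_mult_iff)
    have A [measurable]: "?A \<in> sets borel" by simp
    have "emeasure (interval_measure g) ?A \<le> p * emeasure lborel ?A"
    proof (rule emeasure_le_Vitali)
      show "null_sets lborel \<subseteq> null_sets (interval_measure g)"
        using add by (force simp: null_sets_def)
      fix x d :: real assume x: "x \<in> ?A" "0 < d"
      obtain c r where "0 < r" "r < d" "x \<in> cball c r" "g (c + r) - g (c - r) \<le> p * (2 * r)"
        using osc_set_cover[of x g p q d] x by blast
      then show "\<exists>c r. 0 < r \<and> r < d \<and> x \<in> cball c r \<and>
          emeasure (interval_measure g) (cball c r) \<le> p * emeasure lborel (cball c r)"
        using emeasure_interval_measure_Icc[OF _ mono cont, of "c - r" "c + r"] pq01
        by (intro exI[of _ c] exI[of _ r]) (auto simp: cball ennreal_mult[symmetric] intro!: ennreal_leI)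
    qed (auto simp: pq01)
    moreover have "emeasure (interval_measure (\<lambda>x. x - g x)) ?A \<le> ennreal (1 - q) * emeasure lborel ?A"
    proof (rule emeasure_le_Vitali)
      show "null_sets lborel \<subseteq> null_sets (interval_measure (\<lambda>x. x - g x))"
        using add by (force simp: null_sets_def)
      fix x d :: real assume x: "x \<in> ?A" "0 < d"
      obtain c r where "0 < r" "r < d" "x \<in> cball c r" "q * (2 * r) \<le> g (c + r) - g (c - r)"
        using osc_set_cover[of x g p q d] x by blast
      then show "\<exists>c r. 0 < r \<and> r < d \<and> x \<in> cball c r \<and>
          emeasure (interval_measure (\<lambda>x. x - g x)) (cball c r) \<le> ennreal (1 - q) * emeasure lborel (cball c r)"
        using emeasure_interval_measure_Icc[OF _ mono' cont', of "c - r" "c + r"] pq01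
        by (intro exI[of _ c] exI[of _ r])
          (auto simp: cball ennreal_mult[symmetric] algebra_simps intro!: ennreal_leI)
    qed (auto simp: pq01)
    ultimately have "emeasure (interval_measure g) ?A + emeasure (interval_measure (\<lambda>x. x - g x)) ?A
        \<le> p * emeasure lborel ?A + ennreal (1 - q) * emeasure lborel ?A"
      by (rule add_mono)
    then have "emeasure lborel ?A \<le> p * emeasure lborel ?A + ennreal (1 - q) * emeasure lborel ?A"
      by (simp only: add[OF A])
    moreover have "emeasure lborel ?A \<le> emeasure lborel (cbox (-R) R)" by (intro emeasure_mono) auto
    then have "emeasure lborel ?A < \<infinity>" using emeasure_lborel_cbox_finite order_le_less_trans by blast
    then obtain a where a: "emeasure lborel ?A = ennreal a" "0 \<le> a"
      by (cases "emeasure lborel ?A") (auto simp: top_unique split: if_splits)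
    ultimately have "a \<le> p * a + (1 - q) * a"
      using pq01 by (simp add: ennreal_mult[symmetric] ennreal_plus[symmetric] del: ennreal_plus)
    then have "0 \<le> (p - q) * a" by (simp add: algebra_simps)
    then have "a = 0" using pq a(2) by (simp add: zero_le_mult_iff)
    with a show ?thesis by simp
  qed auto
  then have "(\<Union>n::nat. osc_set g 1 p q \<inter> {- real n..real n}) \<in> null_sets lborel"
    by (intro null_sets_UN) (auto simp: null_sets_def)
  moreover have "(\<Union>n::nat. osc_set g 1 p q \<inter> {- real n..real n}) = osc_set g 1 p q"
  proof -
    have "\<exists>n. - real n \<le> x \<and> x \<le> real n" for x
      using real_arch_simple[of "\<bar>x\<bar>"] by (meson abs_le_iff minus_le_iff)
    then show ?thesis by auto
  qed
  ultimately show ?thesis by simp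
qed

text \<open>The slopes of \<open>g\<close> lie in \<open>[-K, K]\<close>, so those of
  \<open>f = (g + K x) / (2 K)\<close> lie in \<open>[0, 1]\<close>, which is the monotone case. The
  thresholds undergo the same affine change as the slopes.\<close>

lemma osc_set_null_real:
  fixes g :: "real \<Rightarrow> real"
  assumes g: "L-lipschitz_on UNIV g" and pq: "p < q"
  shows "osc_set g 1 p q \<in> null_sets lborel"
proof -
  \<comment> \<open>Positive even when \<open>L = 0\<close>, so that division by
    \<open>2 * K\<close> is allowed.\<close>
  define K where "K = L + 1"
  have K: "0 < K" using lipschitz_on_nonneg[OF g] by (simp add: K_def)
  have bnd: "\<bar>g x - g y\<bar> \<le> K * \<bar>x - y\<bar>" for x y
    using lipschitz_onD[OF g, of x y] abs_ge_zero[of "x - y"]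
    unfolding K_def dist_real_def distrib_right by simp
  define f where "f x = (g x + K * x) / (2 * K)" for x
  have cont: "continuous_on UNIV g" by (rule lipschitz_on_continuous_on[OF g])
  have "osc_set f 1 ((p + K) / (2 * K)) ((q + K) / (2 * K)) \<in> null_sets lborel"
  proof (rule osc_set_null_monotone)
    fix x y :: real assume xy: "x \<le> y"
    have b: "\<bar>g x - g y\<bar> \<le> K * y - K * x" using bnd[of x y] xy by (simp add: right_diff_distrib)
    have *: "z - f z = (K * z - g z) / (2 * K)" for z using K by (simp add: f_def field_simps)
    show "f x \<le> f y" unfolding f_def using b K by (intro divide_right_mono) auto
    show "x - f x \<le> y - f y" unfolding * using b K by (intro divide_right_mono) auto
  next
    show "continuous_on UNIV f" unfolding f_def using K by (intro continuous_intros cont) auto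
    show "(p + K) / (2 * K) < (q + K) / (2 * K)" using K pq by (simp add: divide_strict_right_mono)
  qed
  moreover have "osc_set g 1 p q \<subseteq> osc_set f 1 ((p + K) / (2 * K)) ((q + K) / (2 * K))"
  proof -
    have "(f (y + h *\<^sub>R 1) - f y) / h = ((g (y + h *\<^sub>R 1) - g y) / h + K) / (2 * K)" if "0 < \<bar>h\<bar>" for y h
      using that K by (simp add: f_def field_simps)
    then have "(f (y + h *\<^sub>R 1) - f y) / h < (p + K) / (2 * K) \<longleftrightarrow> (g (y + h *\<^sub>R 1) - g y) / h < p"
       "(q + K) / (2 * K) < (f (y + h *\<^sub>R 1) - f y) / h \<longleftrightarrow> q < (g (y + h *\<^sub>R 1) - g y) / h"
       if "0 < \<bar>h\<bar>" for y h
      using that K by (auto simp: divide_less_cancel)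
    then have "(\<exists>h. 0 < \<bar>h\<bar> \<and> \<bar>h\<bar> < c \<and> (f (y + h *\<^sub>R 1) - f y) / h < (p + K) / (2 * K)) \<longleftrightarrow>
         (\<exists>h. 0 < \<bar>h\<bar> \<and> \<bar>h\<bar> < c \<and> (g (y + h *\<^sub>R 1) - g y) / h < p)"
       "(\<exists>h. 0 < \<bar>h\<bar> \<and> \<bar>h\<bar> < c \<and> (q + K) / (2 * K) < (f (y + h *\<^sub>R 1) - f y) / h) \<longleftrightarrow>
         (\<exists>h. 0 < \<bar>h\<bar> \<and> \<bar>h\<bar> < c \<and> q < (g (y + h *\<^sub>R 1) - g y) / h)" for y c
      by blast+
    then show ?thesis unfolding osc_set_def by simp
  qed
  ultimately show ?thesis
    using null_sets_subset[of _ lborel "osc_set g 1 p q"] osc_set_borel[OF cont] by auto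
qed

section \<open>From lines to the whole space\<close>

text \<open>By translation invariance the measure of \<open>E\<close> is the average over
  \<open>t\<close> in \<open>{0..1}\<close> of the measures of its translates by
  \<open>- t *\<^sub>R u\<close>. After interchanging the integrals, the inner one runs along a line
  and vanishes. No coordinates adapted to \<open>u\<close> are chosen.\<close>

lemma null_sets_if_null_on_lines:
  fixes E :: "'a::euclidean_space set"
  assumes E [measurable]: "E \<in> sets borel"
    and lines: "\<And>y. {t. y + t *\<^sub>R u \<in> E} \<in> null_sets lborel"
  shows "E \<in> null_sets lborel"
proof -
  have "emeasure lborel E = (\<integral>\<^sup>+t. indicator {0..1} t * emeasure lborel E \<partial>(lborel :: real measure))"
    by (simp add: nn_integral_multc)
  also have "\<dots> = (\<integral>\<^sup>+t. (\<integral>\<^sup>+y. indicator {0..1} t * indicator E (y + t *\<^sub>R u) \<partial>lborel) \<partial>lborel)"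
  proof (rule nn_integral_cong)
    fix t :: real
    have "emeasure lborel E = (\<integral>\<^sup>+y. indicator E y \<partial>distr lborel borel ((+) (t *\<^sub>R u)))"
      by (simp add: lborel_distr_plus)
    also have "\<dots> = (\<integral>\<^sup>+y. indicator E (y + t *\<^sub>R u) \<partial>lborel)"
      by (subst nn_integral_distr) (auto simp: add.commute)
    finally show "indicator {0..1} t * emeasure lborel E =
        (\<integral>\<^sup>+y. indicator {0..1} t * indicator E (y + t *\<^sub>R u) \<partial>lborel)"
      by (simp add: nn_integral_cmult)
  qed
  also have "\<dots> = (\<integral>\<^sup>+y. (\<integral>\<^sup>+t. indicator {0..1} t * indicator E (y + t *\<^sub>R u) \<partial>lborel) \<partial>lborel)"
    by (rule lborel_pair.Fubini'[symmetric]) measurable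
  also have "\<dots> = (\<integral>\<^sup>+(y::'a). 0 \<partial>lborel)"
  proof (rule nn_integral_cong)
    fix y :: 'a
    have "AE t in lborel. y + t *\<^sub>R u \<notin> E" using AE_not_in[OF lines[of y]] by simp
    then have "(\<integral>\<^sup>+t. indicator {0..1} t * indicator E (y + t *\<^sub>R u) \<partial>lborel) = (\<integral>\<^sup>+(t::real). 0 \<partial>lborel)"
      by (intro nn_integral_cong_AE) auto
    then show "(\<integral>\<^sup>+t. indicator {0..1} t * indicator E (y + t *\<^sub>R u) \<partial>lborel) = 0" by simp
  qed
  finally show ?thesis by (simp add: null_sets_def)
qed

lemma osc_set_null:
  fixes f :: "'a::euclidean_space \<Rightarrow> real"
  assumes f: "L-lipschitz_on UNIV f" and pq: "p < q"
  shows "osc_set f u p q \<in> null_sets lborel"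
proof (rule null_sets_if_null_on_lines)
  show "osc_set f u p q \<in> sets borel"
    by (rule osc_set_borel[OF lipschitz_on_continuous_on[OF f]])
  fix y
  have "(L * norm u)-lipschitz_on UNIV (\<lambda>t. f (y + t *\<^sub>R u))"
  proof (rule lipschitz_onI)
    fix s t :: real
    have "dist (f (y + s *\<^sub>R u)) (f (y + t *\<^sub>R u)) \<le> L * dist (y + s *\<^sub>R u) (y + t *\<^sub>R u)"
      using lipschitz_onD[OF f] by blast
    also have "dist (y + s *\<^sub>R u) (y + t *\<^sub>R u) = norm u * dist s t"
      by (simp add: dist_norm scaleR_left_diff_distrib[symmetric])
    finally show "dist (f (y + s *\<^sub>R u)) (f (y + t *\<^sub>R u)) \<le> L * norm u * dist s t" by simp
  qed (use lipschitz_on_nonneg[OF f] in auto)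
  then have "osc_set (\<lambda>t. f (y + t *\<^sub>R u)) 1 p q \<in> null_sets lborel" by (rule osc_set_null_real[OF _ pq])
  moreover have "osc_set (\<lambda>t. f (y + t *\<^sub>R u)) 1 p q = {t. y + t *\<^sub>R u \<in> osc_set f u p q}"
    by (auto simp: osc_set_def scaleR_left_distrib add.assoc)
  ultimately show "{t. y + t *\<^sub>R u \<in> osc_set f u p q} \<in> null_sets lborel" by simp
qed

text \<open>If the lower and upper limits differed, two rationals strictly between them would put
  \<open>y\<close> into an \<open>osc_set\<close>. The Lipschitz bound makes their common value
  finite.\<close>

lemma lipschitz_quotient_converges:
  fixes f :: "'a::real_normed_vector \<Rightarrow> real"
  assumes f: "L-lipschitz_on UNIV f"
    and y: "\<And>p q. p \<in> \<rat> \<Longrightarrow> q \<in> \<rat> \<Longrightarrow> p < q \<Longrightarrow> y \<notin> osc_set f u p q"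
  shows "\<exists>l. ((\<lambda>h. (f (y + h *\<^sub>R u) - f y) / h) \<longlongrightarrow> l) (at 0)"
proof -
  define \<phi> where "\<phi> h = (f (y + h *\<^sub>R u) - f y) / h" for h
  have bnd: "\<bar>\<phi> h\<bar> \<le> L * norm u" if "h \<noteq> 0" for h
    using lipschitz_onD[OF f, of "y + h *\<^sub>R u" y] that
    by (simp add: \<phi>_def dist_norm field_simps abs_divide)
  let ?\<phi> = "\<lambda>h. ereal (\<phi> h)"
  have eq: "Liminf (at 0) ?\<phi> = Limsup (at 0) ?\<phi>"
  proof (rule ccontr)
    assume "Liminf (at 0) ?\<phi> \<noteq> Limsup (at 0) ?\<phi>"
    then have "Liminf (at 0) ?\<phi> < Limsup (at 0) ?\<phi>"
      using Liminf_le_Limsup[of "at (0::real)" ?\<phi>] by simp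
    then obtain p where p: "Liminf (at 0) ?\<phi> < ereal (real_of_rat p)" "ereal (real_of_rat p) < Limsup (at 0) ?\<phi>"
      using ereal_dense3 by blast
    then obtain q where q: "ereal (real_of_rat p) < ereal (real_of_rat q)" "ereal (real_of_rat q) < Limsup (at 0) ?\<phi>"
      using ereal_dense3 by blast
    have "\<exists>h. 0 < \<bar>h\<bar> \<and> \<bar>h\<bar> < 1 / Suc k \<and> \<phi> h < real_of_rat p" for k
    proof (rule ccontr)
      assume "\<not> ?thesis"
      then have "\<forall>\<^sub>F h in at 0. ereal (real_of_rat p) \<le> ?\<phi> h"
        by (subst eventually_at) (auto intro!: exI[of _ "1 / Suc k"] simp: not_less)
      from Liminf_bounded[OF this] p show False by simp
    qed
    moreover have "\<exists>h. 0 < \<bar>h\<bar> \<and> \<bar>h\<bar> < 1 / Suc k \<and> real_of_rat q < \<phi> h" for k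
    proof (rule ccontr)
      assume "\<not> ?thesis"
      then have "\<forall>\<^sub>F h in at 0. ?\<phi> h \<le> ereal (real_of_rat q)"
        by (subst eventually_at) (auto intro!: exI[of _ "1 / Suc k"] simp: not_less)
      from Limsup_bounded[OF this] q show False by simp
    qed
    ultimately have "y \<in> osc_set f u (real_of_rat p) (real_of_rat q)"
      by (auto simp: osc_set_def \<phi>_def)
    with y[of "real_of_rat p" "real_of_rat q"] q show False by simp
  qed
  have bnd': "- (L * norm u) \<le> \<phi> h" "\<phi> h \<le> L * norm u" if "h \<noteq> 0" for h
    using bnd[OF that] by linarith+
  have "ereal (- (L * norm u)) \<le> Liminf (at 0) ?\<phi>"
    by (rule Liminf_bounded) (use bnd' in \<open>auto simp: eventually_at intro!: exI[of _ 1]\<close>)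
  moreover have "Limsup (at 0) ?\<phi> \<le> ereal (L * norm u)"
    by (rule Limsup_bounded) (use bnd' in \<open>auto simp: eventually_at intro!: exI[of _ 1]\<close>)
  ultimately obtain l where l: "Liminf (at 0) ?\<phi> = ereal l"
    using eq by (cases "Limsup (at 0) ?\<phi>") auto
  have "(?\<phi> \<longlongrightarrow> ereal l) (at 0)"
    using l eq by (intro Liminf_eq_Limsup) auto
  then show ?thesis unfolding \<phi>_def by auto
qed

lemma lipschitz_directional_derivative_ae:
  fixes f :: "'a::euclidean_space \<Rightarrow> real"
  assumes f: "L-lipschitz_on UNIV f"
  shows "negligible {y. \<not> (\<exists>l. ((\<lambda>h. (f (y + h *\<^sub>R u) - f y) / h) \<longlongrightarrow> l) (at 0))}"
proof -
  have "(\<Union>(p,q)\<in>{(p,q). p \<in> \<rat> \<and> q \<in> \<rat> \<and> p < q}. osc_set f u p q) \<in> null_sets lborel"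
  proof (rule null_sets_UN')
    show "countable {(p::real,q). p \<in> \<rat> \<and> q \<in> \<rat> \<and> p < q}"
      by (rule countable_subset[of _ "\<rat> \<times> \<rat>"]) (auto intro: countable_rat)
  qed (auto intro: osc_set_null[OF f])
  then have "negligible (\<Union>(p,q)\<in>{(p,q). p \<in> \<rat> \<and> q \<in> \<rat> \<and> p < q}. osc_set f u p q)"
    by (simp add: negligible_iff_null_sets null_sets_completionI)
  then show ?thesis
  proof (rule negligible_subset, intro subsetI CollectI)
    fix y assume "y \<in> {y. \<not> (\<exists>l. ((\<lambda>h. (f (y + h *\<^sub>R u) - f y) / h) \<longlongrightarrow> l) (at 0))}"
    then obtain p q where "p \<in> \<rat>" "q \<in> \<rat>" "p < q" "y \<in> osc_set f u p q"
      using lipschitz_quotient_converges[OF f, of y u] by blast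
    then show "y \<in> (\<Union>(p,q)\<in>{(p,q). p \<in> \<rat> \<and> q \<in> \<rat> \<and> p < q}. osc_set f u p q)" by auto
  qed
qed

section \<open>Rademacher's theorem\<close>

text \<open>Each such \<open>y\<close> is the centre of arbitrarily small balls \<open>?B\<close>
  that contain a hole \<open>?D\<close> disjoint from \<open>A\<close> and occupying a fixed
  fraction of the ball. For a disjoint Vitali family inside a tight open neighbourhood
  \<open>U\<close> of a bounded piece \<open>K\<close> of \<open>A\<close>, all holes lie in
  \<open>U - K\<close>. Their total measure is therefore small, and with it that of the balls, which
  cover the piece of the porous set up to a null set.\<close>

lemma porous_subset_negligible:
  fixes A :: "'a::euclidean_space set"
  assumes A: "closed A" and c: "0 < c"
  shows "negligible {y \<in> A. \<forall>d>0. \<exists>w. w \<noteq> 0 \<and> norm w < d \<and> ball (y + w) (c * norm w) \<inter> A = {}}"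
    (is "negligible ?E")
proof -
  \<comment> \<open>The ratio of the volumes of a hole of radius \<open>c * norm w\<close> and of
    the ball of radius \<open>(1 + c) * norm w\<close> around it. Allowing \<open>U\<close> an
    excess of \<open>\<kappa> * e\<close> thus bounds the balls by \<open>e\<close>.\<close>
  define \<kappa> where "\<kappa> = (c / (1 + c)) ^ DIM('a)"
  have \<kappa>: "0 < \<kappa>" using c by (simp add: \<kappa>_def)
  have "negligible (?E \<inter> cball 0 R)" for R
    unfolding negligible_outer
  proof (intro allI impI)
    fix e :: real assume e: "0 < e"
    define K where "K = A \<inter> cball 0 R"
    have [measurable]: "K \<in> sets borel" using A by (simp add: K_def)
    obtain U where U: "open U" "K \<subseteq> U" "emeasure lebesgue (U - K) < ennreal (\<kappa> * e)"
      using sets_lebesgue_outer_open[of K "\<kappa> * e"] \<kappa> e by auto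
    have [measurable]: "U \<in> sets borel" using U by simp
    let ?B = "\<lambda>i::'a \<times> 'a. ball (fst i) ((1 + c) * norm (snd i))"
      and ?D = "\<lambda>i::'a \<times> 'a. ball (fst i + snd i) (c * norm (snd i))"
    define I where "I = {i. ?B i \<subseteq> U \<and> ?D i \<inter> A = {}}"
    obtain C where C: "countable C" "C \<subseteq> I" "pairwise (\<lambda>i j. disjnt (?B i) (?B j)) C"
       "negligible (?E \<inter> cball 0 R - (\<Union>i\<in>C. ?B i))"
    proof (rule Vitali_covering_theorem_balls[of "?E \<inter> cball 0 R" I fst "\<lambda>i. (1 + c) * norm (snd i)"])
      fix y and d :: real assume y: "y \<in> ?E \<inter> cball 0 R" and d: "0 < d"
      then have "y \<in> U" using U(2) by (auto simp: K_def)
      then obtain s where s: "0 < s" "ball y s \<subseteq> U" using U(1) openE by blast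
      have "0 < min d s / (1 + c)" using d s c by simp
      then obtain w where w: "w \<noteq> 0" "norm w < min d s / (1 + c)" "ball (y + w) (c * norm w) \<inter> A = {}"
        using y by blast
      then have "(1 + c) * norm w < min d s" using c by (simp add: field_simps)
      then show "\<exists>i. i \<in> I \<and> y \<in> ?B i \<and> (1 + c) * norm (snd i) < d"
        using w s c by (intro exI[of _ "(y, w)"]) (auto simp: I_def subset_iff)
    qed
    have DB: "?D i \<subseteq> ?B i" for i
    proof
      fix z assume "z \<in> ?D i"
      then show "z \<in> ?B i"
        using norm_triangle_ineq[of "fst i + snd i - z" "- snd i"] c
        by (simp add: dist_norm algebra_simps)
    qed
    have disjB: "disjoint_family_on ?B C"
      using C(3) by (auto simp: pairwise_def disjnt_def disjoint_family_on_def)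
    then have disjD: "disjoint_family_on ?D C" using DB unfolding disjoint_family_on_def by blast
    let ?V = "\<Union>i\<in>C. ?B i"
    have eq: "ennreal \<kappa> * emeasure lborel (?B i) = emeasure lborel (?D i)" for i
      using c by (simp add: emeasure_ball \<kappa>_def ennreal_mult'[symmetric] power_mult_distrib power_divide)
    have "ennreal \<kappa> * emeasure lborel ?V = ennreal \<kappa> * (\<integral>\<^sup>+i. emeasure lborel (?B i) \<partial>count_space C)"
      using C(1) disjB by (subst emeasure_UN_countable) auto
    also have "\<dots> = (\<integral>\<^sup>+i. ennreal \<kappa> * emeasure lborel (?B i) \<partial>count_space C)"
      by (rule nn_integral_cmult[symmetric]) simp
    also have "\<dots> = emeasure lborel (\<Union>i\<in>C. ?D i)"
      unfolding eq using C(1) disjD by (intro emeasure_UN_countable[symmetric]) auto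
    also have "\<dots> \<le> emeasure lborel (U - K)"
    proof (rule emeasure_mono)
      show "(\<Union>i\<in>C. ?D i) \<subseteq> U - K" using C(2) DB by (force simp: I_def K_def)
    qed auto
    also have "\<dots> = emeasure lebesgue (U - K)" by simp
    also have "\<dots> < ennreal (\<kappa> * e)" by (rule U)
    also have "\<dots> = ennreal \<kappa> * ennreal e" using \<kappa> e by (simp add: ennreal_mult)
    finally have *: "ennreal \<kappa> * emeasure lborel ?V < ennreal \<kappa> * ennreal e" .
    have V: "emeasure lborel ?V < ennreal e"
    proof (rule ccontr)
      assume "\<not> emeasure lborel ?V < ennreal e"
      then have "ennreal \<kappa> * ennreal e \<le> ennreal \<kappa> * emeasure lborel ?V"
        by (intro mult_left_mono) auto
      from leD[OF this] * show False by (rule notE)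
    qed
    have Vb: "?V \<in> sets borel" using C(1) by (intro sets.countable_UN') auto
    have Vm: "?V \<in> lmeasurable"
      using V Vb by (intro fmeasurableI) (auto intro: less_trans)
    have "emeasure lborel ?V \<noteq> top" using less_trans[OF V ennreal_less_top] by simp
    from emeasure_eq_ennreal_measure[OF this] V have "ennreal (measure lborel ?V) < ennreal e" by (rule subst)
    then have mV: "measure lebesgue ?V < e" using Vb by (simp add: ennreal_less_iff)
    show "\<exists>T. ?E \<inter> cball 0 R \<subseteq> T \<and> T \<in> lmeasurable \<and> measure lebesgue T < e"
    proof (intro exI conjI)
      let ?N = "?E \<inter> cball 0 R - ?V"
      have N: "?N \<in> lmeasurable" "measure lebesgue ?N = 0"
        using C(4) negligible_iff_measure by blast+
      show "?N \<union> ?V \<in> lmeasurable" using N Vm by blast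
      have "measure lebesgue (?N \<union> ?V) \<le> measure lebesgue ?N + measure lebesgue ?V"
        by (rule measure_Un_le) (use N Vm in auto)
      then show "measure lebesgue (?N \<union> ?V) < e" using N mV by simp
    qed auto
  qed
  then have "negligible (\<Union>n::nat. ?E \<inter> cball 0 (real n))" by (intro negligible_countable_Union) auto
  moreover have "?E \<subseteq> (\<Union>n::nat. ?E \<inter> cball 0 (real n))"
  proof
    fix y assume "y \<in> ?E"
    moreover obtain n where "norm y \<le> real n" using real_arch_simple by blast
    ultimately show "y \<in> (\<Union>n::nat. ?E \<inter> cball 0 (real n))" by auto
  qed
  ultimately show ?thesis by (rule negligible_subset)
qed

section \<open>Total differentiability from partial derivatives\<close>

text \<open>The vector \<open>p\<close> is an approximate gradient. Non-strict inequalities make the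
  set closed for continuous \<open>f\<close>, as the porosity lemma requires, and a scale
  \<open>\<delta>\<close> common to all its points lets the estimate be used at a neighbouring
  point.\<close>

definition near_affine_on_axes :: "('a::euclidean_space \<Rightarrow> real) \<Rightarrow> 'a \<Rightarrow> real \<Rightarrow> real \<Rightarrow> 'a set" where
  "near_affine_on_axes f p \<epsilon> \<delta> =
     {y. \<forall>b\<in>Basis. \<forall>t. \<bar>t\<bar> \<le> \<delta> \<longrightarrow> \<bar>f (y + t *\<^sub>R b) - f y - t * (p \<bullet> b)\<bar> \<le> \<epsilon> * \<bar>t\<bar>}"

lemma closed_near_affine_on_axes:
  assumes "continuous_on UNIV f"
  shows "closed (near_affine_on_axes f p \<epsilon> \<delta>)"
proof -
  have "near_affine_on_axes f p \<epsilon> \<delta> = (\<Inter>b\<in>Basis. \<Inter>t\<in>{t. \<bar>t\<bar> \<le> \<delta>}.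
      {y. \<bar>f (y + t *\<^sub>R b) - f y - t * (p \<bullet> b)\<bar> \<le> \<epsilon> * \<bar>t\<bar>})"
    by (auto simp: near_affine_on_axes_def)
  also have "closed \<dots>"
    by (intro closed_INT ballI closed_Collect_le continuous_intros continuous_on_compose2[OF assms]) auto
  finally show ?thesis .
qed

text \<open>
  Move from \<open>y\<close> to \<open>y + v\<close> one coordinate at a time: by non-porosity each intermediate
  point is close to a point of the set, from which the next step is nearly affine.
\<close>
lemma near_affine_at_nonporous_point:
  fixes f :: "'a::euclidean_space \<Rightarrow> real" and \<epsilon> :: real
  assumes f: "L-lipschitz_on UNIV f" and e: "0 < \<epsilon>" and \<delta>: "0 < \<delta>"
    and c: "c = \<epsilon> / (2 * L + 1)"
    and y: "y \<in> near_affine_on_axes f p \<epsilon> \<delta>"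
    and d: "0 < d" "\<And>w. w \<noteq> 0 \<Longrightarrow> norm w < d \<Longrightarrow> ball (y + w) (c * norm w) \<inter> near_affine_on_axes f p \<epsilon> \<delta> \<noteq> {}"
    and v: "norm v < min d \<delta>"
  shows "\<bar>f (y + v) - f y - p \<bullet> v\<bar> \<le> 2 * real DIM('a) * \<epsilon> * norm v"
proof -
  have L: "0 \<le> L" by (rule lipschitz_on_nonneg[OF f])
  \<comment> \<open>Replacing an intermediate point by a nearby point of the set changes two values
    of \<open>f\<close>, each by at most \<open>L * c * norm v\<close>. The constant
    \<open>c\<close> is chosen so that both together cost at most
    \<open>\<epsilon> * norm v\<close>; near affinity costs as much again, whence
    \<open>2 * \<epsilon>\<close> per coordinate.\<close>
  have c0: "0 < c" "2 * L * c \<le> \<epsilon>" using e L by (auto simp: c field_simps)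
  have lip: "\<bar>f a - f b\<bar> \<le> L * norm (a - b)" for a b
    using lipschitz_onD[OF f, of a b] by (simp add: dist_norm)
  have "\<bar>f (y + (\<Sum>b\<in>I. (v \<bullet> b) *\<^sub>R b)) - f y - (\<Sum>b\<in>I. (v \<bullet> b) * (p \<bullet> b))\<bar> \<le> card I * (2 * \<epsilon> * norm v)"
    if "I \<subseteq> Basis" for I
    using finite_subset[OF that finite_Basis] that
  proof (induction I rule: finite_induct)
    case (insert b I)
    define w where "w = (\<Sum>b\<in>I. (v \<bullet> b) *\<^sub>R b)"
    define t where "t = v \<bullet> b"
    have b: "b \<in> Basis" and I: "I \<subseteq> Basis" using insert.prems by auto
    have nw: "norm w \<le> norm v"
    proof (rule norm_le_componentwise)
      fix b' :: 'a assume b': "b' \<in> Basis"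
      have "w \<bullet> b' = (\<Sum>b\<in>I. if b = b' then v \<bullet> b else 0)"
        unfolding w_def inner_sum_left using b' I by (intro sum.cong) (auto simp: inner_Basis)
      then show "\<bar>w \<bullet> b'\<bar> \<le> \<bar>v \<bullet> b'\<bar>" using insert.hyps(1) by simp
    qed
    obtain z where z: "z \<in> near_affine_on_axes f p \<epsilon> \<delta>" "norm (z - (y + w)) \<le> c * norm v"
    \<comment> \<open>Non-porosity says nothing about \<open>w = 0\<close>, but there
      \<open>y\<close> itself serves.\<close>
    proof (cases "w = 0")
      case True
      then show thesis using that[of y] y c0 by simp
    next
      case False
      then obtain z where "z \<in> near_affine_on_axes f p \<epsilon> \<delta>" "z \<in> ball (y + w) (c * norm w)"
        using d(2)[of w] nw v by force
      moreover from this have "norm (z - (y + w)) \<le> c * norm v"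
        using mult_left_mono[OF nw less_imp_le[OF c0(1)]] by (auto simp: dist_norm norm_minus_commute)
      ultimately show thesis using that by blast
    qed
    have t: "\<bar>t\<bar> \<le> norm v" unfolding t_def by (rule Basis_le_norm[OF b])
    have "\<bar>f (z + t *\<^sub>R b) - f z - t * (p \<bullet> b)\<bar> \<le> \<epsilon> * \<bar>t\<bar>"
      using z(1) t v b by (auto simp: near_affine_on_axes_def)
    also have "\<dots> \<le> \<epsilon> * norm v" using t e by simp
    finally have 1: "\<bar>f (z + t *\<^sub>R b) - f z - t * (p \<bullet> b)\<bar> \<le> \<epsilon> * norm v" .
    have "L * norm (z - (y + w)) \<le> L * (c * norm v)" using z(2) L by (rule mult_left_mono)
    then have 2: "\<bar>f z - f (y + w)\<bar> \<le> L * c * norm v" "\<bar>f (z + t *\<^sub>R b) - f (y + w + t *\<^sub>R b)\<bar> \<le> L * c * norm v"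
      using lip[of z "y + w"] lip[of "z + t *\<^sub>R b" "y + w + t *\<^sub>R b"] by auto
    have "2 * L * c * norm v \<le> \<epsilon> * norm v" using c0 by (intro mult_right_mono) auto
    with 1 2 have "\<bar>f (y + w + t *\<^sub>R b) - f (y + w) - t * (p \<bullet> b)\<bar> \<le> 2 * \<epsilon> * norm v" by linarith
    moreover have "\<bar>f (y + w) - f y - (\<Sum>b\<in>I. (v \<bullet> b) * (p \<bullet> b))\<bar> \<le> card I * (2 * \<epsilon> * norm v)"
      unfolding w_def by (rule insert.IH[OF I])
    moreover have "f (y + (\<Sum>b\<in>insert b I. (v \<bullet> b) *\<^sub>R b)) = f (y + w + t *\<^sub>R b)"
      using insert.hyps by (simp add: w_def t_def add_ac)
    moreover have "(\<Sum>b\<in>insert b I. (v \<bullet> b) * (p \<bullet> b)) = (\<Sum>b\<in>I. (v \<bullet> b) * (p \<bullet> b)) + t * (p \<bullet> b)"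
      using insert.hyps by (simp add: t_def)
    moreover have "real (card (insert b I)) * (2 * \<epsilon> * norm v) = card I * (2 * \<epsilon> * norm v) + 2 * \<epsilon> * norm v"
      using insert.hyps by (simp add: algebra_simps)
    ultimately show ?case by linarith
  qed simp
  from this[OF order_refl] show ?thesis
    by (simp add: euclidean_representation euclidean_inner[of p v] mult.commute mult.left_commute)
qed

text \<open>The exceptional points are those lacking a partial derivative and the porous points of
  the sets \<open>near_affine_on_axes\<close> for \<open>p\<close> in a countable dense set and
  tolerances \<open>1 / Suc m\<close>, \<open>1 / Suc k\<close>. Elsewhere the vector
  \<open>l\<close> of partial derivatives is approximated by such a \<open>p\<close>, since letting
  the gradient itself range over all vectors would give an uncountable union.\<close>

lemma rademacher_real:
  fixes f :: "'a::euclidean_space \<Rightarrow> real"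
  assumes f: "L-lipschitz_on UNIV f"
  shows "negligible {y. \<not> f differentiable (at y)}"
proof -
  have L: "0 \<le> L" by (rule lipschitz_on_nonneg[OF f])
  obtain D :: "'a set" where D: "countable D" "\<And>X. open X \<Longrightarrow> X \<noteq> {} \<Longrightarrow> \<exists>d\<in>D. d \<in> X"
    using countable_dense_exists[where 'a='a] by blast
  define \<epsilon> where "\<epsilon> m = 1 / real (Suc m)" for m
  have \<epsilon>: "0 < \<epsilon> m" for m by (simp add: \<epsilon>_def)
  define P where "P p m k = {y \<in> near_affine_on_axes f p (\<epsilon> m) (\<epsilon> k).
     \<forall>d>0. \<exists>w. w \<noteq> 0 \<and> norm w < d \<and>
       ball (y + w) (\<epsilon> m / (2 * L + 1) * norm w) \<inter> near_affine_on_axes f p (\<epsilon> m) (\<epsilon> k) = {}}" for p m k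
  define X where "X b = {y. \<not> (\<exists>l. ((\<lambda>h. (f (y + h *\<^sub>R b) - f y) / h) \<longlongrightarrow> l) (at 0))}" for b
  have "negligible (P p m k)" for p m k
    unfolding P_def using closed_near_affine_on_axes[OF lipschitz_on_continuous_on[OF f]] \<epsilon>[of m] L
    by (intro porous_subset_negligible) auto
  then have "negligible (\<Union>p\<in>D. \<Union>m. \<Union>k. P p m k)"
    using D(1) by (intro negligible_countable_Union) (auto intro!: negligible_countable_Union)
  moreover have "negligible (X b)" for b
    unfolding X_def by (rule lipschitz_directional_derivative_ae[OF f])
  then have "negligible (\<Union>b\<in>Basis. X b)" by (intro negligible_Union) auto
  ultimately have "negligible ((\<Union>p\<in>D. \<Union>m. \<Union>k. P p m k) \<union> (\<Union>b\<in>Basis. X b))"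
    by (rule negligible_Un)
  moreover have "{y. \<not> f differentiable (at y)} \<subseteq> (\<Union>p\<in>D. \<Union>m. \<Union>k. P p m k) \<union> (\<Union>b\<in>Basis. X b)"
  proof (rule subsetI, rule ccontr)
    fix y assume y: "y \<in> {y. \<not> f differentiable (at y)}"
      and ny: "y \<notin> (\<Union>p\<in>D. \<Union>m. \<Union>k. P p m k) \<union> (\<Union>b\<in>Basis. X b)"
    then have "\<forall>b\<in>Basis. \<exists>l. ((\<lambda>h. (f (y + h *\<^sub>R b) - f y) / h) \<longlongrightarrow> l) (at 0)"
      by (auto simp: X_def)
    then obtain l0 where l0: "\<And>b. b \<in> Basis \<Longrightarrow> ((\<lambda>h. (f (y + h *\<^sub>R b) - f y) / h) \<longlongrightarrow> l0 b) (at 0)"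
      by metis
    define l where "l = (\<Sum>b\<in>Basis. l0 b *\<^sub>R b)"
    have l: "((\<lambda>h. (f (y + h *\<^sub>R b) - f y) / h) \<longlongrightarrow> l \<bullet> b) (at 0)" if "b \<in> Basis" for b
      using l0[OF that] that by (simp add: l_def)
    \<comment> \<open>Of the factor 3, two parts come from the estimate at a non-porous point with
      \<open>p\<close> as gradient and one from replacing \<open>p\<close> by
      \<open>l\<close>.\<close>
    have "\<exists>d>0. \<forall>v::'a. norm v < d \<longrightarrow> \<bar>f (y + v) - f y - l \<bullet> v\<bar> \<le> 3 * real DIM('a) * \<epsilon> m * norm v" for m
    proof -
      \<comment> \<open>One half of \<open>\<epsilon> m\<close> goes to the distance from
        \<open>p\<close> to \<open>l\<close>, the other to the difference quotients along the
        axes.\<close>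
      obtain p where p: "p \<in> D" "norm (p - l) < \<epsilon> m / 2"
        using D(2)[of "ball l (\<epsilon> m / 2)"] \<epsilon>[of m] by (auto simp: dist_norm norm_minus_commute)
      have "\<forall>b\<in>Basis. \<forall>\<^sub>F h in at 0. \<bar>(f (y + h *\<^sub>R b) - f y) / h - l \<bullet> b\<bar> < \<epsilon> m / 2"
      proof
        fix b :: 'a assume "b \<in> Basis"
        from tendstoD[OF l[OF this], of "\<epsilon> m / 2"]
        show "\<forall>\<^sub>F h in at 0. \<bar>(f (y + h *\<^sub>R b) - f y) / h - l \<bullet> b\<bar> < \<epsilon> m / 2"
          using \<epsilon>[of m] by (simp add: dist_real_def)
      qed
      then have "\<forall>\<^sub>F h in at 0. \<forall>b\<in>Basis. \<bar>(f (y + h *\<^sub>R b) - f y) / h - l \<bullet> b\<bar> < \<epsilon> m / 2"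
        by (subst eventually_ball_finite_distrib) auto
      then obtain r where r: "0 < r"
        "\<And>h b. h \<noteq> 0 \<Longrightarrow> \<bar>h\<bar> < r \<Longrightarrow> b \<in> Basis \<Longrightarrow> \<bar>(f (y + h *\<^sub>R b) - f y) / h - l \<bullet> b\<bar> < \<epsilon> m / 2"
        unfolding eventually_at by (auto simp: dist_real_def)
      obtain k where k: "\<epsilon> k < r" using nat_approx_posE[OF r(1)] unfolding \<epsilon>_def by blast
      have mem: "y \<in> near_affine_on_axes f p (\<epsilon> m) (\<epsilon> k)"
        unfolding near_affine_on_axes_def
      proof (intro CollectI ballI allI impI)
        fix b t assume b: "b \<in> (Basis :: 'a set)" and t: "\<bar>t\<bar> \<le> \<epsilon> k"
        show "\<bar>f (y + t *\<^sub>R b) - f y - t * (p \<bullet> b)\<bar> \<le> \<epsilon> m * \<bar>t\<bar>"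
        proof (cases "t = 0")
          case False
          have "\<bar>(p - l) \<bullet> b\<bar> \<le> norm (p - l)" by (rule Basis_le_norm[OF b])
          then have "\<bar>p \<bullet> b - l \<bullet> b\<bar> < \<epsilon> m / 2" using p by (simp add: inner_diff_left)
          moreover have "\<bar>(f (y + t *\<^sub>R b) - f y) / t - l \<bullet> b\<bar> < \<epsilon> m / 2" using r(2)[OF False _ b] t k by simp
          ultimately have "\<bar>(f (y + t *\<^sub>R b) - f y) / t - p \<bullet> b\<bar> \<le> \<epsilon> m" by linarith
          then have "\<bar>(f (y + t *\<^sub>R b) - f y) / t - p \<bullet> b\<bar> * \<bar>t\<bar> \<le> \<epsilon> m * \<bar>t\<bar>" by (rule mult_right_mono) simp
          moreover have "((f (y + t *\<^sub>R b) - f y) / t - p \<bullet> b) * t = f (y + t *\<^sub>R b) - f y - t * (p \<bullet> b)"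
            using False by (simp add: field_simps)
          ultimately show ?thesis by (simp only: abs_mult[symmetric])
        qed simp
      qed
      moreover have "y \<notin> P p m k" using ny p(1) by blast
      ultimately obtain d where d: "0 < d" "\<And>w. w \<noteq> 0 \<Longrightarrow> norm w < d \<Longrightarrow>
          ball (y + w) (\<epsilon> m / (2 * L + 1) * norm w) \<inter> near_affine_on_axes f p (\<epsilon> m) (\<epsilon> k) \<noteq> {}"
        unfolding P_def by blast
      show ?thesis
      proof (intro exI[of _ "min d (\<epsilon> k)"] conjI allI impI)
        fix v :: 'a assume v: "norm v < min d (\<epsilon> k)"
        have "\<bar>f (y + v) - f y - p \<bullet> v\<bar> \<le> 2 * real DIM('a) * \<epsilon> m * norm v"
          by (rule near_affine_at_nonporous_point[OF f \<epsilon> \<epsilon> refl mem d v])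
        moreover have "\<bar>(p - l) \<bullet> v\<bar> \<le> norm (p - l) * norm v" by (rule Cauchy_Schwarz_ineq2)
        then have "\<bar>p \<bullet> v - l \<bullet> v\<bar> \<le> norm (p - l) * norm v" by (simp add: inner_diff_left)
        moreover have "norm (p - l) * norm v \<le> (real DIM('a) * \<epsilon> m) * norm v"
        proof (rule mult_right_mono)
          have "1 * \<epsilon> m \<le> real DIM('a) * \<epsilon> m" using \<epsilon>[of m] DIM_positive[where 'a='a] by (intro mult_right_mono) auto
          then show "norm (p - l) \<le> real DIM('a) * \<epsilon> m" using p \<epsilon>[of m] by linarith
        qed simp
        ultimately show "\<bar>f (y + v) - f y - l \<bullet> v\<bar> \<le> 3 * real DIM('a) * \<epsilon> m * norm v" by linarith
      qed (use d \<epsilon> in auto)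
    qed
    note approx = this
    have "(f has_derivative (\<lambda>v. l \<bullet> v)) (at y)"
      unfolding has_derivative_at_alt
    proof (intro conjI allI impI)
      fix e :: real assume "0 < e"
      then have "0 < e / (3 * DIM('a))" by simp
      then obtain m where m: "\<epsilon> m < e / (3 * DIM('a))" using nat_approx_posE unfolding \<epsilon>_def by blast
      then have m': "3 * real DIM('a) * \<epsilon> m \<le> e" by (simp add: field_simps)
      obtain d where d: "0 < d" "\<And>v. norm v < d \<Longrightarrow> \<bar>f (y + v) - f y - l \<bullet> v\<bar> \<le> 3 * real DIM('a) * \<epsilon> m * norm v"
        using approx[of m] by blast
      show "\<exists>d>0. \<forall>z. norm (z - y) < d \<longrightarrow> norm (f z - f y - l \<bullet> (z - y)) \<le> e * norm (z - y)"
      proof (intro exI[of _ d] conjI allI impI)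
        fix z assume "norm (z - y) < d"
        from d(2)[OF this] show "norm (f z - f y - l \<bullet> (z - y)) \<le> e * norm (z - y)"
          using mult_right_mono[OF m' norm_ge_zero[of "z - y"]] by simp
      qed (rule d)
    qed (rule bounded_linear_inner_right)
    with y show False by (auto simp: differentiable_def)
  qed
  ultimately show ?thesis by (rule negligible_subset)
qed

theorem rademacher:
  fixes f :: "'a::euclidean_space \<Rightarrow> 'b::euclidean_space"
  assumes f: "L-lipschitz_on UNIV f"
  shows "negligible {y. \<not> f differentiable (at y)}"
proof -
  have "negligible {y. \<not> (\<lambda>z. f z \<bullet> b) differentiable (at y)}" if b: "b \<in> Basis" for b
  proof (rule rademacher_real)
    show "L-lipschitz_on UNIV (\<lambda>z. f z \<bullet> b)"
    proof (rule lipschitz_onI)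
      fix y z
      have "dist (f y \<bullet> b) (f z \<bullet> b) = \<bar>(f y - f z) \<bullet> b\<bar>" by (simp add: dist_real_def inner_diff_left)
      also have "\<dots> \<le> dist (f y) (f z)" unfolding dist_norm by (rule Basis_le_norm[OF b])
      also have "\<dots> \<le> L * dist y z" using lipschitz_onD[OF f] by blast
      finally show "dist (f y \<bullet> b) (f z \<bullet> b) \<le> L * dist y z" .
    qed (rule lipschitz_on_nonneg[OF f])
  qed
  then have "negligible (\<Union>b\<in>Basis. {y. \<not> (\<lambda>z. f z \<bullet> b) differentiable (at y)})"
    by (intro negligible_Union) auto
  then show ?thesis
    by (rule negligible_subset) (auto simp: differentiable_componentwise_within[of f])
qed

section \<open>Integration with respect to finitely additive set functions\<close>

locale null_additive =
  fixes \<Omega> :: "'a::euclidean_space set" and \<mu> :: "'a set \<Rightarrow> real"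
  assumes nonneg: "A \<in> borel_subsets \<Omega> \<Longrightarrow> 0 \<le> \<mu> A"
    and add: "A \<in> borel_subsets \<Omega> \<Longrightarrow> B \<in> borel_subsets \<Omega> \<Longrightarrow> A \<inter> B = {} \<Longrightarrow> \<mu> (A \<union> B) = \<mu> A + \<mu> B"
    and null: "A \<in> borel_subsets \<Omega> \<Longrightarrow> emeasure lborel A = 0 \<Longrightarrow> \<mu> A = 0"
begin

lemma measure_empty: "\<mu> {} = 0"
  by (rule null) (auto simp: borel_subsets_def)

lemma mono:
  assumes "A \<in> borel_subsets \<Omega>" "B \<in> borel_subsets \<Omega>" "A \<subseteq> B"
  shows "\<mu> A \<le> \<mu> B"
proof -
  have "B - A \<in> borel_subsets \<Omega>" using assms by (auto simp: borel_subsets_def)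
  moreover have "A \<union> (B - A) = B" using assms(3) by blast
  ultimately show ?thesis using add[of A "B - A"] nonneg[of "B - A"] assms by auto
qed

lemma finite_Union:
  assumes "finite I" "\<And>i. i \<in> I \<Longrightarrow> f i \<in> borel_subsets \<Omega>" "disjoint_family_on f I"
  shows "(\<Union>i\<in>I. f i) \<in> borel_subsets \<Omega> \<and> \<mu> (\<Union>i\<in>I. f i) = (\<Sum>i\<in>I. \<mu> (f i))"
  using assms
proof (induction I rule: finite_induct)
  case empty
  show ?case by (simp add: measure_empty borel_subsets_def)
next
  case (insert i I)
  have IH: "(\<Union>i\<in>I. f i) \<in> borel_subsets \<Omega>" "\<mu> (\<Union>i\<in>I. f i) = (\<Sum>i\<in>I. \<mu> (f i))"
    using insert.IH insert.prems by (auto simp: disjoint_family_on_def)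
  have fi: "f i \<in> borel_subsets \<Omega>" using insert.prems by auto
  have "f i \<inter> (\<Union>i\<in>I. f i) = {}" using insert by (fastforce simp: disjoint_family_on_def)
  from add[OF fi IH(1) this] IH fi insert.hyps show ?case by (auto simp: borel_subsets_def)
qed

text \<open>The level sets of \<open>h\<close> are grouped by the value of \<open>\<phi>\<close>.
  With \<open>h\<close> the pair of two step functions this is their common refinement, from which
  linearity follows.\<close>

lemma step_integral_refine:
  assumes fin: "finite (h ` A)"
    and meas: "\<And>c. c \<in> h ` A \<Longrightarrow> h -` {c} \<inter> A \<in> borel_subsets \<Omega>"
    and s: "\<And>y. y \<in> A \<Longrightarrow> s y = \<phi> (h y)"
  shows "step_integral \<mu> A s = (\<Sum>c\<in>h ` A. \<phi> c * \<mu> (h -` {c} \<inter> A))"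
proof -
  have sA: "s ` A = \<phi> ` h ` A" using s by force
  have "(\<Sum>d\<in>s ` A. \<Sum>c\<in>{c \<in> h ` A. \<phi> c = d}. \<phi> c * \<mu> (h -` {c} \<inter> A)) = (\<Sum>c\<in>h ` A. \<phi> c * \<mu> (h -` {c} \<inter> A))"
    using fin sA by (intro sum.group) auto
  moreover have "(\<Sum>c\<in>{c \<in> h ` A. \<phi> c = d}. \<phi> c * \<mu> (h -` {c} \<inter> A)) = d * \<mu> (s -` {d} \<inter> A)" for d
  proof -
    have "\<mu> (\<Union>c\<in>{c \<in> h ` A. \<phi> c = d}. h -` {c} \<inter> A) = (\<Sum>c\<in>{c \<in> h ` A. \<phi> c = d}. \<mu> (h -` {c} \<inter> A))"
      using fin meas by (intro finite_Union[THEN conjunct2]) (auto simp: disjoint_family_on_def)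
    moreover have "(\<Union>c\<in>{c \<in> h ` A. \<phi> c = d}. h -` {c} \<inter> A) = s -` {d} \<inter> A" using s by auto
    ultimately show ?thesis by (simp add: sum_distrib_left)
  qed
  ultimately show ?thesis by (simp add: step_integral_def)
qed

lemma simple_function_vimage:
  assumes "simple_function borel s" "A \<in> borel_subsets \<Omega>"
  shows "finite (s ` A)" "s -` {c} \<inter> A \<in> borel_subsets \<Omega>"
  using simple_functionD[OF assms(1)] assms(2) finite_subset[of "s ` A" "range s"]
  by (auto simp: borel_subsets_def intro!: sets.Int)

lemma step_integral_add_scaled:
  assumes s: "simple_function borel s" and t: "simple_function borel t" and A: "A \<in> borel_subsets \<Omega>"
  shows "step_integral \<mu> A (\<lambda>y. a * s y + b * t y) = a * step_integral \<mu> A s + b * step_integral \<mu> A t"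
proof -
  define h where "h y = (s y, t y)" for y
  have h: "simple_function borel h" unfolding h_def by (rule simple_function_Pair[OF s t])
  note refine = step_integral_refine[OF simple_function_vimage[OF h A]]
  have "step_integral \<mu> A (\<lambda>y. a * s y + b * t y) = (\<Sum>c\<in>h ` A. (a * fst c + b * snd c) * \<mu> (h -` {c} \<inter> A))"
    by (rule refine) (simp add: h_def)
  also have "\<dots> = a * (\<Sum>c\<in>h ` A. fst c * \<mu> (h -` {c} \<inter> A)) + b * (\<Sum>c\<in>h ` A. snd c * \<mu> (h -` {c} \<inter> A))"
    by (simp add: sum_distrib_left sum.distrib distrib_right mult.assoc)
  also have "(\<Sum>c\<in>h ` A. fst c * \<mu> (h -` {c} \<inter> A)) = step_integral \<mu> A s"
    by (rule refine[symmetric]) (simp add: h_def)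
  also have "(\<Sum>c\<in>h ` A. snd c * \<mu> (h -` {c} \<inter> A)) = step_integral \<mu> A t"
    by (rule refine[symmetric]) (simp add: h_def)
  finally show ?thesis .
qed

lemma step_integral_le:
  assumes s: "simple_function borel s" and A: "A \<in> borel_subsets \<Omega>"
    and Z: "Z \<in> null_sets lebesgue" and le: "\<And>y. y \<in> A - Z \<Longrightarrow> s y \<le> c"
  shows "step_integral \<mu> A s \<le> c * \<mu> A"
proof -
  note v = simple_function_vimage[OF s A]
  have "d * \<mu> (s -` {d} \<inter> A) \<le> c * \<mu> (s -` {d} \<inter> A)" for d
  \<comment> \<open>A level set inside \<open>Z\<close> is Borel and Lebesgue null, hence not seen
    by \<open>\<mu>\<close>; any other one has a point outside \<open>Z\<close>, where the bound
    gives \<open>d \<le> c\<close>.\<close>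
  proof (cases "s -` {d} \<inter> A \<subseteq> Z")
    case True
    have "s -` {d} \<inter> A \<in> sets lborel" using v(2)[of d] by (simp add: borel_subsets_def)
    moreover have "s -` {d} \<inter> A \<in> null_sets lebesgue"
      using True Z calculation by (intro null_sets_subset[OF Z]) auto
    ultimately have "emeasure lborel (s -` {d} \<inter> A) = 0"
      using null_sets_completion_iff null_setsD1 by blast
    with null[OF v(2)] show ?thesis by simp
  next
    case False
    then have "d \<le> c" using le by auto
    then show ?thesis using nonneg[OF v(2)] by (rule mult_right_mono)
  qed
  then have "step_integral \<mu> A s \<le> (\<Sum>d\<in>s ` A. c * \<mu> (s -` {d} \<inter> A))"
    unfolding step_integral_def by (intro sum_mono)
  also have "\<dots> = c * (\<Sum>d\<in>s ` A. \<mu> (s -` {d} \<inter> A))" by (simp add: sum_distrib_left)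
  also have "(\<Sum>d\<in>s ` A. \<mu> (s -` {d} \<inter> A)) = \<mu> (\<Union>d\<in>s ` A. s -` {d} \<inter> A)"
    using v by (intro finite_Union[THEN conjunct2, symmetric]) (auto simp: disjoint_family_on_def)
  also have "(\<Union>d\<in>s ` A. s -` {d} \<inter> A) = A" by auto
  finally show ?thesis .
qed

lemma step_integral_diff_le:
  assumes s: "simple_function borel s" and t: "simple_function borel t" and A: "A \<in> borel_subsets \<Omega>"
    and Z: "Z \<in> null_sets lebesgue" and le: "\<And>y. y \<in> A - Z \<Longrightarrow> \<bar>s y - t y\<bar> \<le> e"
  shows "\<bar>step_integral \<mu> A s - step_integral \<mu> A t\<bar> \<le> e * \<mu> A"
proof -
  have *: "step_integral \<mu> A f - step_integral \<mu> A g \<le> e * \<mu> A"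
    if f: "simple_function borel f" and g: "simple_function borel g" and le: "\<And>y. y \<in> A - Z \<Longrightarrow> f y - g y \<le> e" for f g
  proof -
    have "step_integral \<mu> A (\<lambda>y. 1 * f y + (-1) * g y) \<le> e * \<mu> A"
      using f g le by (intro step_integral_le[OF _ A Z] simple_function_add simple_function_mult simple_function_const) auto
    then show ?thesis using step_integral_add_scaled[OF f g A, of 1 "-1"] by simp
  qed
  have "s y - t y \<le> e" "t y - s y \<le> e" if "y \<in> A - Z" for y using le[OF that] by linarith+
  from *[OF s t this(1)] *[OF t s this(2)] show ?thesis by linarith
qed

lemma has_ba_integral_add_scaled:
  assumes f: "has_ba_integral \<mu> A f I" and g: "has_ba_integral \<mu> A g J" and A: "A \<in> borel_subsets \<Omega>"
  shows "has_ba_integral \<mu> A (\<lambda>y. a * f y + b * g y) (a * I + b * J)"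
proof -
  obtain s Y where s: "Y \<in> null_sets lebesgue" "\<And>k::nat. simple_function borel (s k)"
    "uniform_limit (A - Y) s f sequentially" "(\<lambda>k. step_integral \<mu> A (s k)) \<longlonglongrightarrow> I"
    using f unfolding has_ba_integral_def by blast
  obtain t Z where t: "Z \<in> null_sets lebesgue" "\<And>k::nat. simple_function borel (t k)"
    "uniform_limit (A - Z) t g sequentially" "(\<lambda>k. step_integral \<mu> A (t k)) \<longlonglongrightarrow> J"
    using g unfolding has_ba_integral_def by blast
  show ?thesis
    unfolding has_ba_integral_def
  proof (intro exI conjI allI)
    show "Y \<union> Z \<in> null_sets lebesgue" using s(1) t(1) by blast
    show "simple_function borel (\<lambda>y. a * s k y + b * t k y)" for k
      using s(2) t(2) by (intro simple_function_add simple_function_mult simple_function_const)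
    have "uniform_limit (A - (Y \<union> Z)) s f sequentially" "uniform_limit (A - (Y \<union> Z)) t g sequentially"
      using s(3) t(3) by (auto intro: uniform_limit_on_subset)
    then show "uniform_limit (A - (Y \<union> Z)) (\<lambda>k y. a * s k y + b * t k y) (\<lambda>y. a * f y + b * g y) sequentially"
      by (intro uniform_limit_add bounded_linear.uniform_limit[OF bounded_linear_mult_right])
    show "(\<lambda>k. step_integral \<mu> A (\<lambda>y. a * s k y + b * t k y)) \<longlonglongrightarrow> a * I + b * J"
      unfolding step_integral_add_scaled[OF s(2) t(2) A] by (intro tendsto_intros s t)
  qed
qed

lemma has_ba_integral_sum:
  assumes "finite S" and "\<And>i. i \<in> S \<Longrightarrow> has_ba_integral \<mu> A (f i) (I i)" and A: "A \<in> borel_subsets \<Omega>"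
  shows "has_ba_integral \<mu> A (\<lambda>y. \<Sum>i\<in>S. c i * f i y) (\<Sum>i\<in>S. c i * I i)"
  using assms(1,2)
proof (induction S rule: finite_induct)
  case empty
  have "step_integral \<mu> A (\<lambda>y. 0) = 0" unfolding step_integral_def by (rule sum.neutral) auto
  then show ?case
    unfolding has_ba_integral_def
    by (intro exI[of _ "\<lambda>k y. 0"] exI[of _ "{}"]) (auto simp: uniform_limit_const)
next
  case (insert i S)
  then have "has_ba_integral \<mu> A (f i) (I i)"
    and "has_ba_integral \<mu> A (\<lambda>y. \<Sum>i\<in>S. c i * f i y) (\<Sum>i\<in>S. c i * I i)" by auto
  from has_ba_integral_add_scaled[OF this A, of "c i" 1] insert.hyps show ?case by simp
qed

lemma has_ba_integral_le:
  assumes g: "has_ba_integral \<mu> A g I" and A: "A \<in> borel_subsets \<Omega>"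
    and Y: "Y \<in> null_sets lebesgue" and le: "\<And>y. y \<in> A - Y \<Longrightarrow> g y \<le> c"
  shows "I \<le> c * \<mu> A"
proof -
  obtain s Z where s: "Z \<in> null_sets lebesgue" "\<And>k::nat. simple_function borel (s k)"
    "uniform_limit (A - Z) s g sequentially" "(\<lambda>k. step_integral \<mu> A (s k)) \<longlonglongrightarrow> I"
    using g unfolding has_ba_integral_def by blast
  have "I \<le> (c + e) * \<mu> A" if e: "0 < e" for e
  proof (rule tendsto_upperbound[OF s(4)])
    from uniform_limitD[OF s(3) e]
    show "\<forall>\<^sub>F k in sequentially. step_integral \<mu> A (s k) \<le> (c + e) * \<mu> A"
    proof eventually_elim
      case (elim k)
      have "s k y \<le> c + e" if y: "y \<in> A - (Y \<union> Z)" for y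
      proof -
        have "dist (s k y) (g y) < e" "g y \<le> c" using elim le y by auto
        then show ?thesis by (simp add: dist_real_def)
      qed
      then show ?case by (intro step_integral_le[OF s(2) A, of "Y \<union> Z"]) (use Y s(1) in auto)
    qed
  qed simp
  then have "I \<le> c * \<mu> A + e * \<mu> A" if "0 < e" for e using that by (simp add: distrib_right)
  note * = this
  show ?thesis
  proof (rule field_le_epsilon)
    fix e :: real assume "0 < e"
    moreover have "0 \<le> \<mu> A" by (rule nonneg[OF A])
    ultimately have "0 < e / (\<mu> A + 1)" "e / (\<mu> A + 1) * \<mu> A \<le> e" by (auto simp: field_simps)
    with *[of "e / (\<mu> A + 1)"] show "I \<le> c * \<mu> A + e" by linarith
  qed
qed

text \<open>By linearity \<open>I - J\<close> is an integral of \<open>g - g = 0\<close>, hence at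
  most 0, and symmetrically.\<close>

lemma has_ba_integral_unique:
  assumes "has_ba_integral \<mu> A g I" "has_ba_integral \<mu> A g J" and A: "A \<in> borel_subsets \<Omega>"
  shows "I = J"
proof -
  have "I - J \<le> 0" if "has_ba_integral \<mu> A g I" "has_ba_integral \<mu> A g J" for I J
    using has_ba_integral_le[OF has_ba_integral_add_scaled[OF that A, of 1 "-1"] A, of "{}" 0] by auto
  from this[OF assms(1,2)] this[OF assms(2,1)] show ?thesis by simp
qed

text \<open>Lets one approximating sequence serve several set functions at once, while the
  definition only provides some sequence for each.\<close>

lemma has_ba_integral_approx:
  assumes g: "has_ba_integral \<mu> A g I" and A: "A \<in> borel_subsets \<Omega>"
    and t: "Y \<in> null_sets lebesgue" "\<And>k::nat. simple_function borel (t k)" "uniform_limit (A - Y) t g sequentially"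
  shows "(\<lambda>k. step_integral \<mu> A (t k)) \<longlonglongrightarrow> I"
proof -
  obtain s Z where s: "Z \<in> null_sets lebesgue" "\<And>k::nat. simple_function borel (s k)"
    "uniform_limit (A - Z) s g sequentially" "(\<lambda>k. step_integral \<mu> A (s k)) \<longlonglongrightarrow> I"
    using g unfolding has_ba_integral_def by blast
  have "(\<lambda>k. step_integral \<mu> A (t k) - step_integral \<mu> A (s k)) \<longlonglongrightarrow> 0"
  proof (rule tendstoI)
    fix e :: real assume e: "0 < e"
    define e' where "e' = e / (2 * (\<mu> A + 1))"
    have \<mu>: "0 \<le> \<mu> A" by (rule nonneg[OF A])
    then have e': "0 < e'" "2 * e' * \<mu> A < e" using e by (auto simp: e'_def field_simps)
    from uniform_limitD[OF s(3) e'(1)] uniform_limitD[OF t(3) e'(1)]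
    show "\<forall>\<^sub>F k in sequentially. dist (step_integral \<mu> A (t k) - step_integral \<mu> A (s k)) 0 < e"
    proof eventually_elim
      case (elim k)
      have "\<bar>t k y - s k y\<bar> \<le> 2 * e'" if y: "y \<in> A - (Y \<union> Z)" for y
      proof -
        have "dist (s k y) (g y) < e'" "dist (t k y) (g y) < e'" using elim y by auto
        then show ?thesis by (simp add: dist_real_def)
      qed
      then have "\<bar>step_integral \<mu> A (t k) - step_integral \<mu> A (s k)\<bar> \<le> 2 * e' * \<mu> A"
        by (intro step_integral_diff_le[OF t(2) s(2) A, of "Y \<union> Z"]) (use t(1) s(1) in auto)
      then show ?case using e'(2) by (simp add: dist_real_def)
    qed
  qed
  from tendsto_add[OF this s(4)] show ?thesis by simp
qed

text \<open>The level sets in \<open>A\<close> and in \<open>B\<close> differ only inside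
  \<open>A - B\<close>, which has measure 0 by additivity. This gives the independence of the radius
  in \<open>dens_integral\<close>.\<close>

lemma has_ba_integral_subset:
  assumes g: "has_ba_integral \<mu> A g I" and A: "A \<in> borel_subsets \<Omega>" and B: "B \<in> borel_subsets \<Omega>"
    and BA: "B \<subseteq> A" and eq: "\<mu> A = \<mu> B"
  shows "has_ba_integral \<mu> B g I"
proof -
  have step: "step_integral \<mu> A s = step_integral \<mu> B s" if s: "simple_function borel s" for s
  proof -
    have "\<mu> (A - B) = 0"
    proof -
      have "A - B \<in> borel_subsets \<Omega>" using A B by (auto simp: borel_subsets_def)
      moreover have "B \<union> (A - B) = A" using BA by blast
      ultimately show ?thesis using add[of B "A - B"] B eq by auto
    qed
    have "\<mu> (s -` {c} \<inter> A) = \<mu> (s -` {c} \<inter> B)" for c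
    proof -
      have v: "s -` {c} \<inter> B \<in> borel_subsets \<Omega>" "s -` {c} \<inter> (A - B) \<in> borel_subsets \<Omega>" "A - B \<in> borel_subsets \<Omega>"
        using simple_function_vimage(2)[OF s B, of c] simple_function_vimage(2)[OF s A, of c] A B
        by (auto simp: borel_subsets_def Int_Diff[symmetric])
      have "(s -` {c} \<inter> B) \<union> (s -` {c} \<inter> (A - B)) = s -` {c} \<inter> A" using BA by blast
      moreover have "\<mu> (s -` {c} \<inter> (A - B)) = 0"
        using mono[OF v(2,3)] nonneg[OF v(2)] \<open>\<mu> (A - B) = 0\<close> by auto
      ultimately show ?thesis using add[OF v(1,2)] by auto
    qed
    then have "step_integral \<mu> A s = (\<Sum>c\<in>s ` A. c * \<mu> (s -` {c} \<inter> B))" by (simp add: step_integral_def)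
    also have "\<dots> = (\<Sum>c\<in>s ` B. c * \<mu> (s -` {c} \<inter> B))"
    proof (rule sum.mono_neutral_right)
      show "finite (s ` A)" by (rule simple_function_vimage[OF s A])
      show "s ` B \<subseteq> s ` A" using BA by blast
      have "s -` {c} \<inter> B = {}" if "c \<in> s ` A - s ` B" for c using that by (auto simp: image_iff)
      then show "\<forall>c\<in>s ` A - s ` B. c * \<mu> (s -` {c} \<inter> B) = 0" by (simp add: measure_empty)
    qed
    finally show ?thesis by (simp add: step_integral_def)
  qed
  obtain s Z where s: "Z \<in> null_sets lebesgue" "\<And>k::nat. simple_function borel (s k)"
    "uniform_limit (A - Z) s g sequentially" "(\<lambda>k. step_integral \<mu> A (s k)) \<longlonglongrightarrow> I"
    using g unfolding has_ba_integral_def by blast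
  show ?thesis
    unfolding has_ba_integral_def
  proof (intro exI conjI allI)
    show "uniform_limit (B - Z) s g sequentially" by (rule uniform_limit_on_subset[OF s(3)]) (use BA in auto)
    show "(\<lambda>k. step_integral \<mu> B (s k)) \<longlonglongrightarrow> I" using s(4) by (simp add: step[OF s(2)])
  qed (use s in auto)
qed

end

text \<open>Rounding down to multiples of \<open>1 / Suc k\<close>; boundedness leaves finitely many
  values.\<close>

lemma simple_approximation:
  fixes g :: "'a::topological_space \<Rightarrow> real"
  assumes g: "g \<in> borel_measurable borel" and M: "\<And>y. \<bar>g y\<bar> \<le> M"
  obtains s where "\<And>k::nat. simple_function borel (s k)" "\<And>k y. \<bar>s k y - g y\<bar> \<le> 1 / Suc k"
proof
  define s where "s k y = real_of_int \<lfloor>Suc k * g y\<rfloor> / Suc k" for k :: nat and y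
  show "simple_function borel (s k)" for k
  proof (rule simple_function_borel_measurable)
    show "s k \<in> borel_measurable borel" unfolding s_def using g by measurable
    have "\<lfloor>Suc k * g y\<rfloor> \<in> {\<lfloor>- (Suc k * M)\<rfloor>..\<lfloor>Suc k * M\<rfloor>}" for y
    proof -
      have "Suc k * \<bar>g y\<bar> \<le> Suc k * M" using M[of y] by (intro mult_left_mono) auto
      moreover have "\<bar>Suc k * g y\<bar> = Suc k * \<bar>g y\<bar>" by (simp add: abs_mult del: of_nat_Suc)
      ultimately have "- (Suc k * M) \<le> Suc k * g y" "Suc k * g y \<le> Suc k * M" by linarith+
      then show ?thesis by (auto intro: floor_mono)
    qed
    then have "range (s k) \<subseteq> (\<lambda>i. real_of_int i / Suc k) ` {\<lfloor>- (Suc k * M)\<rfloor>..\<lfloor>Suc k * M\<rfloor>}"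
      by (auto simp: s_def)
    then show "finite (s k ` space borel)" by (simp add: finite_subset)
  qed
  show "\<bar>s k y - g y\<bar> \<le> 1 / Suc k" for k y
  proof -
    have "\<bar>real_of_int \<lfloor>Suc k * g y\<rfloor> - Suc k * g y\<bar> \<le> 1" by linarith
    then have "\<bar>real_of_int \<lfloor>Suc k * g y\<rfloor> - Suc k * g y\<bar> / Suc k \<le> 1 / Suc k" by (rule divide_right_mono) simp
    moreover have "s k y - g y = (real_of_int \<lfloor>Suc k * g y\<rfloor> - Suc k * g y) / Suc k"
      by (simp add: s_def field_simps)
    ultimately show ?thesis by (simp add: abs_divide)
  qed
qed

lemma uniform_limit_if_le_inverse_Suc:
  fixes g :: "'a \<Rightarrow> real"
  assumes "\<And>k y. y \<in> A \<Longrightarrow> \<bar>s k y - g y\<bar> \<le> 1 / Suc k"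
  shows "uniform_limit A s g sequentially"
proof (rule uniform_limitI)
  fix e :: real assume "0 < e"
  from order_tendstoD(2)[OF LIMSEQ_inverse_real_of_nat this]
  show "\<forall>\<^sub>F k in sequentially. \<forall>y\<in>A. dist (s k y) (g y) < e"
    by eventually_elim (use assms in \<open>auto simp: dist_real_def inverse_eq_divide intro: le_less_trans\<close>)
qed

text \<open>Uniformly close step functions have close step integrals, so these form a Cauchy
  sequence. The integrand \<open>f\<close> is kept apart from its Borel version \<open>g\<close>
  because DF is controlled only off a null set.\<close>

lemma (in null_additive) has_ba_integral_exists:
  assumes g: "g \<in> borel_measurable borel" "\<And>y. \<bar>g y\<bar> \<le> M" and A: "A \<in> borel_subsets \<Omega>"
    and Z: "Z \<in> null_sets lebesgue" and f: "\<And>y. y \<in> A - Z \<Longrightarrow> f y = g y"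
  shows "\<exists>I. has_ba_integral \<mu> A f I"
proof -
  obtain s where s: "\<And>k::nat. simple_function borel (s k)" "\<And>k y. \<bar>s k y - g y\<bar> \<le> 1 / Suc k"
    using simple_approximation[OF g] by blast
  have "Cauchy (\<lambda>k. step_integral \<mu> A (s k))"
  proof (rule metric_CauchyI)
    fix e :: real assume e: "0 < e"
    have \<mu>: "0 \<le> \<mu> A" by (rule nonneg[OF A])
    then have "0 < e / (2 * (\<mu> A + 1))" using e by simp
    then obtain N where N: "1 / Suc N < e / (2 * (\<mu> A + 1))" using nat_approx_posE by blast
    have "2 * (1 / Suc N) * \<mu> A \<le> 2 * (1 / Suc N) * (\<mu> A + 1)" by (intro mult_left_mono) auto
    also have "\<dots> < e" using N \<mu> by (simp add: field_simps)
    finally have N': "2 * (1 / Suc N) * \<mu> A < e" .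
    show "\<exists>N. \<forall>m\<ge>N. \<forall>n\<ge>N. dist (step_integral \<mu> A (s m)) (step_integral \<mu> A (s n)) < e"
    proof (intro exI[of _ N] allI impI)
      fix m n assume mn: "N \<le> m" "N \<le> n"
      have "\<bar>s m y - s n y\<bar> \<le> 2 * (1 / Suc N)" for y
      proof -
        have "1 / real (Suc m) \<le> 1 / Suc N" "1 / real (Suc n) \<le> 1 / Suc N" using mn by (auto simp: field_simps)
        then show ?thesis using s(2)[of m y] s(2)[of n y] by linarith
      qed
      then have "\<bar>step_integral \<mu> A (s m) - step_integral \<mu> A (s n)\<bar> \<le> 2 * (1 / Suc N) * \<mu> A"
        by (intro step_integral_diff_le[OF s(1) s(1) A null_sets.empty_sets])
      then show "dist (step_integral \<mu> A (s m)) (step_integral \<mu> A (s n)) < e"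
        using N' by (simp add: dist_real_def)
    qed
  qed
  then obtain I where "(\<lambda>k. step_integral \<mu> A (s k)) \<longlonglongrightarrow> I" using convergent_eq_Cauchy by blast
  moreover have "uniform_limit (A - Z) s f sequentially"
    by (rule uniform_limit_if_le_inverse_Suc) (use s(2) f in auto)
  ultimately show ?thesis using s(1) Z unfolding has_ba_integral_def by blast
qed

section \<open>Integrals with respect to elements of \<open>Dens\<close>\<close>

lemma Dens_null_additive:
  assumes "\<mu> \<in> Dens \<Omega> x"
  shows "null_additive \<Omega> \<mu>"
  using assms by unfold_locales (auto simp: Dens_def ba_def)

text \<open>Justifies the definite description in \<open>dens_integral\<close>: integrals over two
  balls are both integrals over the smaller one, where they agree by uniqueness.\<close>

lemma dens_integral_eq:
  assumes \<mu>: "\<mu> \<in> Dens \<Omega> x" and \<delta>: "0 < \<delta>" "ball x \<delta> \<subseteq> \<Omega>"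
    and g: "has_ba_integral \<mu> (ball x \<delta>) g I"
  shows "dens_integral \<Omega> x \<mu> g = I"
  unfolding dens_integral_def
proof (rule the_equality)
  show "\<exists>\<delta>>0. ball x \<delta> \<subseteq> \<Omega> \<and> has_ba_integral \<mu> (ball x \<delta>) g I" using \<delta> g by blast
next
  interpret null_additive \<Omega> \<mu> by (rule Dens_null_additive[OF \<mu>])
  fix J assume "\<exists>\<delta>>0. ball x \<delta> \<subseteq> \<Omega> \<and> has_ba_integral \<mu> (ball x \<delta>) g J"
  then obtain \<eta> where \<eta>: "0 < \<eta>" "ball x \<eta> \<subseteq> \<Omega>" "has_ba_integral \<mu> (ball x \<eta>) g J" by blast
  have B: "ball x r \<in> borel_subsets \<Omega>" if "ball x r \<subseteq> \<Omega>" for r using that by (simp add: borel_subsets_def)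
  have one: "\<mu> (ball x r) = 1" if "0 < r" "ball x r \<subseteq> \<Omega>" for r
    using \<mu> that by (auto simp: Dens_def Int_absorb2)
  define r where "r = min \<delta> \<eta>"
  have r: "0 < r" "ball x r \<subseteq> \<Omega>" "ball x r \<subseteq> ball x \<delta>" "ball x r \<subseteq> ball x \<eta>"
    using \<delta> \<eta> by (auto simp: r_def)
  have "has_ba_integral \<mu> (ball x r) g I"
    by (rule has_ba_integral_subset[OF g B[OF \<delta>(2)] B[OF r(2)] r(3)]) (simp add: one \<delta> r)
  moreover have "has_ba_integral \<mu> (ball x r) g J"
    by (rule has_ba_integral_subset[OF \<eta>(3) B[OF \<eta>(2)] B[OF r(2)] r(4)]) (simp add: one \<eta> r)
  ultimately show "J = I" using has_ba_integral_unique[OF _ _ B[OF r(2)]] by blast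
qed

lemma Dens_convex_combination:
  assumes \<mu>: "\<mu> \<in> Dens \<Omega> x" and \<nu>: "\<nu> \<in> Dens \<Omega> x" and uv: "0 \<le> u" "0 \<le> v" "u + v = (1::real)"
  shows "(\<lambda>A. u * \<mu> A + v * \<nu> A) \<in> Dens \<Omega> x"
proof -
  obtain C D where "\<forall>A\<in>borel_subsets \<Omega>. \<bar>\<mu> A\<bar> \<le> C" "\<forall>A\<in>borel_subsets \<Omega>. \<bar>\<nu> A\<bar> \<le> D"
    using \<mu> \<nu> by (auto simp: Dens_def ba_def)
  then have "\<bar>u * \<mu> A + v * \<nu> A\<bar> \<le> u * C + v * D" if "A \<in> borel_subsets \<Omega>" for A
    using that uv by (intro order_trans[OF abs_triangle_ineq]) (auto simp: abs_mult intro!: add_mono mult_left_mono)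
  then have "\<exists>C. \<forall>A\<in>borel_subsets \<Omega>. \<bar>u * \<mu> A + v * \<nu> A\<bar> \<le> C" by blast
  moreover have "u * \<mu> (A \<union> B) + v * \<nu> (A \<union> B) = u * \<mu> A + v * \<nu> A + (u * \<mu> B + v * \<nu> B)"
    if "A \<in> borel_subsets \<Omega>" "B \<in> borel_subsets \<Omega>" "A \<inter> B = {}" for A B
  proof -
    have "\<mu> (A \<union> B) = \<mu> A + \<mu> B" "\<nu> (A \<union> B) = \<nu> A + \<nu> B"
      using \<mu> \<nu> that by (auto simp: Dens_def ba_def)
    then show ?thesis by (simp add: algebra_simps)
  qed
  ultimately show ?thesis using \<mu> \<nu> uv by (auto simp: Dens_def ba_def)
qed

text \<open>The sequence that comes with the integral for \<open>\<mu>\<close> also computes the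
  integral for \<open>\<nu>\<close>, and step integrals are linear in the set function.\<close>

lemma has_ba_integral_convex_combination:
  assumes "null_additive \<Omega> \<mu>" "null_additive \<Omega> \<nu>" and A: "A \<in> borel_subsets \<Omega>"
    and I: "has_ba_integral \<mu> A g I" and J: "has_ba_integral \<nu> A g J"
  shows "has_ba_integral (\<lambda>A. u * \<mu> A + v * \<nu> A) A g (u * I + v * J)"
proof -
  interpret \<nu>: null_additive \<Omega> \<nu> by fact
  obtain s Z where s: "Z \<in> null_sets lebesgue" "\<And>k::nat. simple_function borel (s k)"
    "uniform_limit (A - Z) s g sequentially" "(\<lambda>k. step_integral \<mu> A (s k)) \<longlonglongrightarrow> I"
    using I unfolding has_ba_integral_def by blast
  have "(\<lambda>k. step_integral \<nu> A (s k)) \<longlonglongrightarrow> J"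
    by (rule \<nu>.has_ba_integral_approx[OF J A s(1-3)])
  moreover have "step_integral (\<lambda>A. u * \<mu> A + v * \<nu> A) A f = u * step_integral \<mu> A f + v * step_integral \<nu> A f" for f
    by (simp add: step_integral_def sum_distrib_left sum.distrib algebra_simps)
  ultimately have "(\<lambda>k. step_integral (\<lambda>A. u * \<mu> A + v * \<nu> A) A (s k)) \<longlonglongrightarrow> u * I + v * J"
    using s(4) by (auto intro!: tendsto_intros)
  then show ?thesis using s unfolding has_ba_integral_def by blast
qed

text \<open>A weak form of the Banach-Alaoglu theorem: compactness of the product of unit intervals.\<close>
lemma set_function_cluster_point:
  fixes \<nu> :: "nat \<Rightarrow> 'a set \<Rightarrow> real"
  assumes "\<And>k A. 0 \<le> \<nu> k A \<and> \<nu> k A \<le> 1"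
  obtains \<mu> G where "G \<noteq> bot" "G \<le> filtermap \<nu> sequentially" "\<And>A. ((\<lambda>\<rho>. \<rho> A) \<longlongrightarrow> \<mu> A) G"
proof -
  have "compactin (product_topology (\<lambda>_. euclidean) UNIV) (\<Pi>\<^sub>E A\<in>(UNIV :: 'a set set). {0..1::real})"
    by (simp add: compactin_PiE)
  then have K: "compact (\<Pi>\<^sub>E A\<in>(UNIV :: 'a set set). {0..1::real})"
    by (simp add: euclidean_product_topology)
  have ev: "eventually (\<lambda>\<rho>. \<rho> \<in> (\<Pi>\<^sub>E A\<in>(UNIV :: 'a set set). {0..1::real})) (filtermap \<nu> sequentially)"
    using assms by (auto simp: eventually_filtermap PiE_def)
  \<comment> \<open>The limit is taken along a filter finer than the image of
    \<open>sequentially\<close>, since no subsequence need converge at all sets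
    simultaneously.\<close>
  obtain \<mu> where \<mu>: "inf (nhds \<mu>) (filtermap \<nu> sequentially) \<noteq> bot"
    using K[unfolded compact_filter, rule_format, OF _ ev] by (auto simp: filtermap_bot_iff)
  show thesis
  proof
    show "inf (nhds \<mu>) (filtermap \<nu> sequentially) \<noteq> bot" by fact
    show "((\<lambda>\<rho>. \<rho> A) \<longlongrightarrow> \<mu> A) (inf (nhds \<mu>) (filtermap \<nu> sequentially))" for A
    proof (rule tendsto_mono)
      show "((\<lambda>\<rho>. \<rho> A) \<longlongrightarrow> \<mu> A) (nhds \<mu>)"
      proof (rule topological_tendstoI)
        fix S :: "real set" assume S: "open S" "\<mu> A \<in> S"
        have "open ((\<lambda>\<rho>::'a set \<Rightarrow> real. \<rho> A) -` S)"
          by (rule open_vimage[OF S(1) continuous_on_product_coordinates])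
        then show "\<forall>\<^sub>F \<rho> in nhds \<mu>. \<rho> A \<in> S"
          using S(2) unfolding eventually_nhds by (intro exI[of _ "(\<lambda>\<rho>. \<rho> A) -` S"]) auto
      qed
    qed simp
  qed simp
qed

section \<open>Means over shrinking sets\<close>

lemma step_integral_mean:
  fixes s :: "'a::euclidean_space \<Rightarrow> real"
  assumes s: "simple_function borel s" and Q: "Q \<in> sets borel" "bounded Q" "Q \<subseteq> B" and B: "B \<in> sets borel"
  shows "step_integral (\<lambda>A. measure lborel (A \<inter> Q) / measure lborel Q) B s =
    (\<integral>y. indicator Q y * s y \<partial>lborel) / measure lborel Q"
proof -
  have fin: "finite (s ` B)"
    using simple_functionD(1)[OF s] by (auto intro: finite_subset[of "s ` B" "range s"])
  have meas: "s -` {c} \<inter> B \<inter> Q \<in> sets lborel" for c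
    using simple_functionD(2)[OF s, of "{c}"] Q B by (auto intro!: sets.Int)
  have fm: "emeasure lborel (s -` {c} \<inter> B \<inter> Q) < \<infinity>" for c
    using Q(2) by (intro emeasure_bounded_finite) (auto intro: bounded_subset)
  have "indicator Q y * s y = (\<Sum>c\<in>s ` B. c * indicator (s -` {c} \<inter> B \<inter> Q) y)" for y
  proof (cases "y \<in> Q")
    case True
    then have "(\<Sum>c\<in>s ` B. c * indicator (s -` {c} \<inter> B \<inter> Q) y) = (\<Sum>c\<in>s ` B. if c = s y then s y else 0)"
      using Q(3) by (intro sum.cong) (auto simp: indicator_def)
    with True Q(3) fin show ?thesis by auto
  qed simp
  then have "(\<integral>y. indicator Q y * s y \<partial>lborel) = (\<Sum>c\<in>s ` B. c * measure lborel (s -` {c} \<inter> B \<inter> Q))"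
    using meas fm by simp
  then show ?thesis
    by (simp add: step_integral_def sum_divide_distrib)
qed

lemma mean_diff_le:
  fixes f g :: "'a::euclidean_space \<Rightarrow> real"
  assumes f: "f \<in> borel_measurable borel" "\<And>y. \<bar>f y\<bar> \<le> M" and g: "g \<in> borel_measurable borel" "\<And>y. \<bar>g y\<bar> \<le> M"
    and Q: "Q \<in> sets borel" "bounded Q" "0 < measure lborel Q" and e: "\<And>y. \<bar>f y - g y\<bar> \<le> e"
  shows "\<bar>(\<integral>y. indicator Q y * f y \<partial>lborel) / measure lborel Q - (\<integral>y. indicator Q y * g y \<partial>lborel) / measure lborel Q\<bar> \<le> e"
proof -
  have Qfin: "emeasure lborel Q < \<infinity>" by (rule emeasure_bounded_finite[OF Q(2)])
  have int: "integrable lborel (\<lambda>y. indicator Q y * h y)"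
    if h: "h \<in> borel_measurable borel" "\<And>y. \<bar>h y\<bar> \<le> K" for h :: "'a \<Rightarrow> real" and K
  proof (rule Bochner_Integration.integrable_bound)
    show "integrable lborel (\<lambda>y. K * indicator Q y)" using Q Qfin by auto
    show "(\<lambda>y. indicator Q y * h y) \<in> borel_measurable lborel" using h Q by measurable
    have "\<bar>h y\<bar> \<le> \<bar>K\<bar>" for y using h(2)[of y] by linarith
    then show "AE y in lborel. norm (indicator Q y * h y) \<le> norm (K * indicator Q y)"
      by (auto simp: indicator_def)
  qed
  have d: "(\<integral>y. indicator Q y * f y \<partial>lborel) - (\<integral>y. indicator Q y * g y \<partial>lborel) = (\<integral>y. indicator Q y * (f y - g y) \<partial>lborel)"
    using int[OF f] int[OF g] by (simp add: right_diff_distrib)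
  have "\<bar>\<integral>y. indicator Q y * (f y - g y) \<partial>lborel\<bar> \<le> (\<integral>y. e * indicator Q y \<partial>lborel)"
  proof (rule order_trans[OF integral_abs_bound integral_mono])
    show "integrable lborel (\<lambda>y. \<bar>indicator Q y * (f y - g y)\<bar>)"
      using f(1) g(1) e by (intro integrable_abs int[of _ e]) auto
    show "integrable lborel (\<lambda>y. e * indicator Q y)" using Q Qfin by auto
    show "\<bar>indicator Q y * (f y - g y)\<bar> \<le> e * indicator Q y" for y
      using e[of y] by (auto simp: indicator_def)
  qed
  also have "\<dots> = e * measure lborel Q" using Q Qfin by simp
  finally show ?thesis
    using Q(3) d by (simp add: diff_divide_distrib[symmetric] abs_divide pos_divide_le_eq)
qed

text \<open>
  The set function is a cluster point of the normalised Lebesgue measures on the sets \<open>Q k\<close>,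
  which shrink to \<open>x\<close>.
\<close>
lemma Dens_of_means:
  fixes Q :: "nat \<Rightarrow> 'a::euclidean_space set"
  assumes \<Omega>: "open \<Omega>" "x \<in> \<Omega>"
    and Q: "\<And>k. Q k \<in> sets borel" "\<And>k. 0 < measure lborel (Q k)" "\<And>k. Q k \<subseteq> ball x (1 / Suc k)"
  obtains \<mu> where "\<mu> \<in> Dens \<Omega> x"
    "\<And>r f g M a Z. 0 < r \<Longrightarrow> ball x r \<subseteq> \<Omega> \<Longrightarrow> g \<in> borel_measurable borel \<Longrightarrow> (\<And>y. \<bar>g y\<bar> \<le> M) \<Longrightarrow>
       Z \<in> null_sets lebesgue \<Longrightarrow> (\<And>y. y \<in> ball x r - Z \<Longrightarrow> f y = g y) \<Longrightarrow>
       (\<lambda>k. (\<integral>y. indicator (Q k) y * g y \<partial>lborel) / measure lborel (Q k)) \<longlonglongrightarrow> a \<Longrightarrow>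
       has_ba_integral \<mu> (ball x r) f a"
proof -
  have bQ: "bounded (Q k)" for k using Q(3) bounded_ball bounded_subset by blast
  have fQ: "emeasure lborel (Q k) < \<infinity>" for k by (rule emeasure_bounded_finite[OF bQ])
  have fmQ: "A \<inter> Q k \<in> fmeasurable lborel" if "A \<in> sets borel" for A k
    using that Q(1) bQ by (intro fmeasurableI emeasure_bounded_finite bounded_Int) (auto intro!: sets.Int)
  define \<nu> where "\<nu> k A = measure lborel (A \<inter> Q k) / measure lborel (Q k)" for k A
  have \<nu>01: "0 \<le> \<nu> k A \<and> \<nu> k A \<le> 1" for k A
  proof (cases "A \<inter> Q k \<in> sets lborel")
    case True
    then have "measure lborel (A \<inter> Q k) \<le> measure lborel (Q k)"
      using fmQ[of UNIV k] by (intro measure_mono_fmeasurable) auto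
    with Q(2)[of k] show ?thesis by (simp add: \<nu>_def)
  next
    \<comment> \<open>The cluster point lemma wants bounds at all sets; on non-measurable ones
      \<open>measure\<close> has the default value 0.\<close>
    case False
    then show ?thesis by (simp add: \<nu>_def measure_notin_sets)
  qed
  have small: "\<forall>\<^sub>F k in sequentially. Q k \<subseteq> U" if U: "open U" "x \<in> U" for U
  proof -
    obtain r where r: "0 < r" "ball x r \<subseteq> U" using U openE by blast
    obtain N where N: "1 / real (Suc N) < r" using nat_approx_posE[OF r(1)] by blast
    have "Q k \<subseteq> U" if "N \<le> k" for k
    proof -
      have "1 / real (Suc k) \<le> 1 / Suc N" using that by (simp add: field_simps)
      then have "ball x (1 / real (Suc k)) \<subseteq> ball x r" using N by (intro subset_ball) linarith
      then show ?thesis using Q(3)[of k] r(2) by blast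
    qed
    then show ?thesis unfolding eventually_sequentially by blast
  qed
  obtain \<mu> G where G: "G \<noteq> bot" "G \<le> filtermap \<nu> sequentially" and lim: "\<And>A. ((\<lambda>\<rho>. \<rho> A) \<longlongrightarrow> \<mu> A) G"
    by (rule set_function_cluster_point[of \<nu>, OF \<nu>01], rule that)
  have ev: "\<forall>\<^sub>F \<rho> in G. P \<rho>" if "\<forall>\<^sub>F k in sequentially. P (\<nu> k)" for P
    using that G(2) by (simp add: le_filter_def eventually_filtermap)
  \<comment> \<open>Identities that hold along the sequence from some index on pass to the cluster
    point.\<close>
  have eq: "u = v" if "(f \<longlongrightarrow> u) G" "(g \<longlongrightarrow> v) G" "\<forall>\<^sub>F k in sequentially. f (\<nu> k) = g (\<nu> k)"
    for f g and u v :: real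
  proof -
    have "\<forall>\<^sub>F \<rho> in G. f \<rho> = g \<rho>" by (rule ev[OF that(3)])
    then have "(f \<longlongrightarrow> v) G" using that(2) tendsto_cong by blast
    with that(1) show ?thesis by (rule tendsto_unique[OF G(1)])
  qed
  have nonneg: "0 \<le> \<mu> A" for A
    by (rule tendsto_lowerbound[OF lim ev G(1)]) (simp add: \<nu>01)
  have le_one: "\<mu> A \<le> 1" for A
    by (rule tendsto_upperbound[OF lim ev G(1)]) (simp add: \<nu>01)
  have \<nu>_add: "\<nu> k (A \<union> B) = \<nu> k A + \<nu> k B"
    if "A \<in> sets borel" "B \<in> sets borel" "A \<inter> B = {}" for k A B
  proof -
    have "(A \<inter> Q k) \<inter> (B \<inter> Q k) = {}" using that(3) by blast
    then have "measure lborel ((A \<inter> Q k) \<union> (B \<inter> Q k)) = measure lborel (A \<inter> Q k) + measure lborel (B \<inter> Q k)"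
      by (simp only: measure_Un3[OF fmQ[OF that(1)] fmQ[OF that(2)]]) simp
    then show ?thesis by (simp add: \<nu>_def Int_Un_distrib2 add_divide_distrib)
  qed
  \<comment> \<open>Almost all \<open>Q k\<close> lie in \<open>U\<close>. This yields both the
    total mass and the concentration at \<open>x\<close>.\<close>
  have one: "\<mu> U = 1" if U: "open U" "x \<in> U" for U
  proof (rule eq[OF lim tendsto_const])
    from small[OF U] show "\<forall>\<^sub>F k in sequentially. \<nu> k U = 1"
    proof eventually_elim
      case (elim k)
      then have "U \<inter> Q k = Q k" by blast
      with Q(2)[of k] show ?case by (simp add: \<nu>_def)
    qed
  qed
  have \<mu>: "\<mu> \<in> Dens \<Omega> x"
    unfolding Dens_def ba_def mem_Collect_eq
  proof (intro conjI ballI impI allI)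
    show "\<exists>C. \<forall>A\<in>borel_subsets \<Omega>. \<bar>\<mu> A\<bar> \<le> C" using nonneg le_one by (intro exI[of _ 1]) auto
    show "\<mu> (A \<union> B) = \<mu> A + \<mu> B" if "A \<in> borel_subsets \<Omega>" "B \<in> borel_subsets \<Omega>" "A \<inter> B = {}" for A B
      using that by (intro eq[OF lim tendsto_add[OF lim lim]] always_eventually allI \<nu>_add)
        (auto simp: borel_subsets_def)
    show "\<mu> A = 0" if A: "A \<in> borel_subsets \<Omega>" "emeasure lborel A = 0" for A
    proof (rule eq[OF lim tendsto_const], intro always_eventually allI)
      fix k
      have "emeasure lborel (A \<inter> Q k) \<le> emeasure lborel A"
        using A(1) by (intro emeasure_mono) (auto simp: borel_subsets_def)
      then show "\<nu> k A = 0" using A(2) by (simp add: \<nu>_def measure_def)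
    qed
    show "\<mu> \<Omega> = 1" using \<Omega> by (rule one)
    show "\<mu> (ball x \<delta> \<inter> \<Omega>) = 1" if "0 < \<delta>" for \<delta> using \<Omega> that by (intro one) auto
  qed (rule nonneg)
  interpret \<mu>: null_additive \<Omega> \<mu> by (rule Dens_null_additive[OF \<mu>])
  show thesis
  proof (rule that[OF \<mu>])
    fix r f g M a Z
    assume r: "0 < r" "ball x r \<subseteq> \<Omega>" and g: "g \<in> borel_measurable borel" "\<And>y. \<bar>g y\<bar> \<le> M"
      and Z: "Z \<in> null_sets lebesgue" and f: "\<And>y. y \<in> ball x r - Z \<Longrightarrow> f y = g y"
      and a: "(\<lambda>k. (\<integral>y. indicator (Q k) y * g y \<partial>lborel) / measure lborel (Q k)) \<longlonglongrightarrow> a"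
    have B: "ball x r \<in> borel_subsets \<Omega>" using r by (simp add: borel_subsets_def)
    obtain I where I: "has_ba_integral \<mu> (ball x r) f I"
      using \<mu>.has_ba_integral_exists[OF g B Z f] by blast
    obtain s where s: "\<And>k::nat. simple_function borel (s k)" "\<And>k y. \<bar>s k y - g y\<bar> \<le> 1 / Suc k"
      using simple_approximation[OF g] by blast
    have I_lim: "(\<lambda>m. step_integral \<mu> (ball x r) (s m)) \<longlonglongrightarrow> I"
      by (rule \<mu>.has_ba_integral_approx[OF I B Z s(1)], rule uniform_limit_if_le_inverse_Suc)
        (use s(2) f in auto)
    \<comment> \<open>The means of \<open>s m\<close> and \<open>g\<close> over \<open>Q k\<close>
      differ by at most \<open>1 / Suc m\<close> for all large \<open>k\<close>, which allows the
      limit in \<open>k\<close> to be taken before that in \<open>m\<close>.\<close>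
    have step: "\<bar>step_integral \<mu> (ball x r) (s m) - a\<bar> \<le> 1 / Suc m" for m
    proof (rule field_le_epsilon)
      fix e :: real assume e: "0 < e"
      \<comment> \<open>For a fixed step function the step integral is a finite combination of
        values of the set function, so convergence at each set suffices.\<close>
      have lim_step: "((\<lambda>\<rho>. \<bar>step_integral \<rho> (ball x r) (s m) - a\<bar>) \<longlongrightarrow> \<bar>step_integral \<mu> (ball x r) (s m) - a\<bar>) G"
        unfolding step_integral_def by (intro tendsto_intros lim)
      show "\<bar>step_integral \<mu> (ball x r) (s m) - a\<bar> \<le> 1 / Suc m + e"
      proof (rule tendsto_upperbound[OF lim_step ev G(1)])
        from small[of "ball x r"] tendstoD[OF a e] r(1)
        have "\<forall>\<^sub>F k in sequentially. Q k \<subseteq> ball x r \<and>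
            dist ((\<integral>y. indicator (Q k) y * g y \<partial>lborel) / measure lborel (Q k)) a < e"
          by (auto intro: eventually_conj)
        then show "\<forall>\<^sub>F k in sequentially. \<bar>step_integral (\<nu> k) (ball x r) (s m) - a\<bar> \<le> 1 / Suc m + e"
        proof eventually_elim
          case (elim k)
          have s_bnd: "\<bar>s m y\<bar> \<le> M + 1" for y
          proof -
            have "1 / real (Suc m) \<le> 1" by simp
            then show ?thesis using s(2)[of m y] g(2)[of y] by linarith
          qed
          have "\<bar>g y\<bar> \<le> M + 1" for y using g(2)[of y] by linarith
          then have "\<bar>(\<integral>y. indicator (Q k) y * s m y \<partial>lborel) / measure lborel (Q k) -
              (\<integral>y. indicator (Q k) y * g y \<partial>lborel) / measure lborel (Q k)\<bar> \<le> 1 / Suc m"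
            using s(2) by (intro mean_diff_le[OF borel_measurable_simple_function[OF s(1)] s_bnd g(1) _ Q(1) bQ Q(2)]) auto
          moreover have "step_integral (\<nu> k) (ball x r) (s m) = (\<integral>y. indicator (Q k) y * s m y \<partial>lborel) / measure lborel (Q k)"
            unfolding \<nu>_def using elim by (intro step_integral_mean[OF s(1) Q(1) bQ]) auto
          ultimately show ?case using elim unfolding dist_real_def by linarith
        qed
      qed
    qed
    have "(\<lambda>m. step_integral \<mu> (ball x r) (s m)) \<longlonglongrightarrow> a"
    proof (rule LIM_zero_cancel, rule tendsto_rabs_zero_cancel, rule tendsto_sandwich[OF _ _ tendsto_const LIMSEQ_inverse_real_of_nat])
      show "\<forall>\<^sub>F m in sequentially. \<bar>step_integral \<mu> (ball x r) (s m) - a\<bar> \<le> inverse (real (Suc m))"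
        using step by (simp add: inverse_eq_divide)
    qed simp
    with I_lim have "I = a" by (rule LIMSEQ_unique)
    with I show "has_ba_integral \<mu> (ball x r) f a" by simp
  qed
qed

section \<open>Cubes and means of difference quotients\<close>

text \<open>The radius \<open>\<delta>\<close> is half the side length. Cubes are preferred to balls
  because the overlap of a cube with its translate along an axis is a box of explicit
  volume.\<close>

definition cube :: "real^'n \<Rightarrow> real \<Rightarrow> (real^'n) set" where
  "cube y \<delta> = cbox (y - (\<chi> i. \<delta>)) (y + (\<chi> i. \<delta>))"

lemma measure_cube:
  fixes y :: "real^'n"
  assumes "0 \<le> \<delta>"
  shows "measure lborel (cube y \<delta>) = (2 * \<delta>) ^ CARD('n)"
proof -
  have "y \<in> cube y \<delta>" using assms by (simp add: cube_def mem_box_cart)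
  then show ?thesis unfolding cube_def by (subst content_cbox_cart) auto
qed

lemma cube_subset_ball:
  fixes y :: "real^'n"
  assumes "real CARD('n) * \<delta> < r"
  shows "cube y \<delta> \<subseteq> ball y r"
proof
  fix z assume "z \<in> cube y \<delta>"
  then have "\<bar>(z - y) $ i\<bar> \<le> \<delta>" for i
    by (auto simp: cube_def mem_box_cart abs_le_iff algebra_simps dest: spec[of _ i])
  then have "norm (z - y) \<le> (\<Sum>i\<in>(UNIV :: 'n set). \<delta>)"
    by (intro order_trans[OF norm_le_l1_cart] sum_mono) auto
  with assms show "z \<in> ball y r" by (simp add: dist_norm norm_minus_commute)
qed

text \<open>The overlap is the cube with its side in direction \<open>j\<close> shortened from
  \<open>2 * \<delta>\<close> to \<open>2 * \<delta> - h\<close>.\<close>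

lemma measure_cube_Int_translate:
  fixes y :: "real^'n"
  assumes "0 \<le> h" "h \<le> \<delta>" "0 < \<delta>"
  shows "measure lborel (cube y \<delta> \<inter> cube (y + h *\<^sub>R axis j 1) \<delta>) = (1 - h / (2 * \<delta>)) * measure lborel (cube y \<delta>)"
proof -
  have "cube y \<delta> \<inter> cube (y + h *\<^sub>R axis j 1) \<delta> = cbox (y + h *\<^sub>R axis j 1 - (\<chi> i. \<delta>)) (y + (\<chi> i. \<delta>))" (is "_ = ?C")
  proof (rule set_eqI)
    fix z :: "real^'n"
    define t where "t i = (if i = j then h else 0)" for i
    have t: "0 \<le> t i" "(y + h *\<^sub>R axis j 1) $ i = y $ i + t i" for i
      using assms(1) by (auto simp: t_def axis_def)
    have "z \<in> cube y \<delta> \<inter> cube (y + h *\<^sub>R axis j 1) \<delta> \<longleftrightarrow>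
        (\<forall>i. (y $ i - \<delta> \<le> z $ i \<and> z $ i \<le> y $ i + \<delta>) \<and> y $ i + t i - \<delta> \<le> z $ i \<and> z $ i \<le> y $ i + t i + \<delta>)"
      unfolding cube_def Int_iff mem_box_cart vector_minus_component vector_add_component[of _ "\<chi> i. \<delta>"] t
      by auto
    also have "\<dots> \<longleftrightarrow> (\<forall>i. y $ i + t i - \<delta> \<le> z $ i \<and> z $ i \<le> y $ i + \<delta>)"
    proof (rule all_cong1)
      fix i
      from t(1)[of i]
      show "((y $ i - \<delta> \<le> z $ i \<and> z $ i \<le> y $ i + \<delta>) \<and> y $ i + t i - \<delta> \<le> z $ i \<and> z $ i \<le> y $ i + t i + \<delta>) \<longleftrightarrow>
          (y $ i + t i - \<delta> \<le> z $ i \<and> z $ i \<le> y $ i + \<delta>)" by linarith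
    qed
    also have "\<dots> \<longleftrightarrow> z \<in> ?C"
      unfolding mem_box_cart vector_minus_component vector_add_component[of _ "\<chi> i. \<delta>"] t by auto
    finally show "z \<in> cube y \<delta> \<inter> cube (y + h *\<^sub>R axis j 1) \<delta> \<longleftrightarrow> z \<in> ?C" .
  qed
  moreover have "measure lborel ?C = (\<Prod>i\<in>UNIV. if i = j then 2 * \<delta> - h else 2 * \<delta>)"
  proof -
    have "y \<in> ?C" using assms by (simp add: mem_box_cart axis_def)
    then have "?C \<noteq> {}" by blast
    then show ?thesis by (subst content_cbox_cart) (simp, intro prod.cong refl, simp add: axis_def)
  qed
  also have "\<dots> = (2 * \<delta> - h) * (\<Prod>i\<in>UNIV - {j}. 2 * \<delta>)"
    by (subst prod.remove[of _ j]) auto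
  also have "\<dots> = (1 - h / (2 * \<delta>)) * (2 * \<delta>) ^ CARD('n)"
  proof -
    have "(2 * \<delta>) ^ CARD('n) = 2 * \<delta> * (2 * \<delta>) ^ (CARD('n) - 1)"
      by (metis power_minus_mult mult.commute zero_less_card_finite)
    then show ?thesis using assms(3) by (simp add: card_Diff_singleton field_simps)
  qed
  ultimately show ?thesis using assms(3) by (simp add: measure_cube)
qed

lemma integrable_indicator_continuous:
  fixes f :: "'a::euclidean_space \<Rightarrow> real"
  assumes "continuous_on UNIV f" "compact S"
  shows "integrable lborel (\<lambda>z. indicator S z * f z)"
  using borel_integrable_compact[OF assms(2) continuous_on_subset[OF assms(1)]] by simp

text \<open>
  Translating the cube instead of the function turns a mean of difference quotients into an
  integral over the symmetric difference of two cubes, whose measure is proportional to \<open>h\<close>.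
\<close>
lemma difference_quotient_mean_le:
  fixes \<phi> :: "real^'n \<Rightarrow> real" and h \<delta> :: real
  assumes \<phi>: "continuous_on UNIV \<phi>" and h: "0 < h" "h \<le> \<delta>"
    and b: "\<And>z. norm (z - y) \<le> 2 * CARD('n) * \<delta> \<Longrightarrow> \<bar>\<phi> z\<bar> \<le> b"
  shows "\<bar>\<integral>z. indicator (cube y \<delta>) z * ((\<phi> (z + h *\<^sub>R axis j 1) - \<phi> z) / h) \<partial>lborel\<bar> \<le> b / \<delta> * measure lborel (cube y \<delta>)"
proof -
  define e where "e = h *\<^sub>R (axis j 1 :: real^'n)"
  let ?Q = "cube y \<delta>" and ?Q' = "cube (y + e) \<delta>"
  have \<delta>: "0 < \<delta>" using h by linarith
  have compact: "compact (cube w \<delta>)" for w :: "real^'n" by (simp add: cube_def)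
  have [measurable]: "cube w \<delta> \<in> sets borel" for w :: "real^'n" by (simp add: cube_def)
  have fm: "cube w \<delta> \<in> fmeasurable lborel" for w :: "real^'n" by (simp add: cube_def)
  have int: "integrable lborel (\<lambda>z. indicator (cube w \<delta>) z * \<phi> z)" for w
    by (rule integrable_indicator_continuous[OF \<phi> compact])
  have int_e: "integrable lborel (\<lambda>z. indicator ?Q z * \<phi> (z + e))"
    by (intro integrable_indicator_continuous compact continuous_on_compose2[OF \<phi>] continuous_intros) auto
  have "(\<integral>z. indicator ?Q' z * \<phi> z \<partial>lborel) = (\<integral>z. indicator ?Q' z * \<phi> z \<partial>distr lborel borel ((+) e))"
    by (simp add: lborel_distr_plus)
  also have "\<dots> = (\<integral>z. indicator ?Q' (e + z) * \<phi> (e + z) \<partial>lborel)"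
    using borel_measurable_continuous_onI[OF \<phi>] by (intro integral_distr) measurable
  also have "\<dots> = (\<integral>z. indicator ?Q z * \<phi> (z + e) \<partial>lborel)"
    by (intro Bochner_Integration.integral_cong refl)
      (auto simp: cube_def mem_box_cart indicator_def algebra_simps)
  finally have trans: "(\<integral>z. indicator ?Q z * \<phi> (z + e) \<partial>lborel) = (\<integral>z. indicator ?Q' z * \<phi> z \<partial>lborel)" ..
  have near: "\<bar>\<phi> z\<bar> \<le> b" if z: "z \<in> ?Q \<union> ?Q'" for z
  proof (rule b)
    \<comment> \<open>One \<open>\<delta>\<close> for the half side and one for the shift, because
      \<open>h \<le> \<delta>\<close>; summing over the coordinates gives the radius in hypothesis
      \<open>b\<close>.\<close>
    have "\<bar>(z - y) $ i\<bar> \<le> 2 * \<delta>" for i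
    proof -
      have "0 \<le> e $ i" "e $ i \<le> \<delta>" using h by (auto simp: e_def axis_def)
      moreover have "\<bar>z $ i - y $ i\<bar> \<le> \<delta> \<or> \<bar>z $ i - (y $ i + e $ i)\<bar> \<le> \<delta>"
        using z by (auto simp: cube_def mem_box_cart abs_le_iff algebra_simps dest: spec[of _ i])
      ultimately show ?thesis unfolding vector_minus_component by arith
    qed
    then have "norm (z - y) \<le> (\<Sum>i\<in>(UNIV :: 'n set). 2 * \<delta>)"
      by (intro order_trans[OF norm_le_l1_cart] sum_mono) auto
    then show "norm (z - y) \<le> 2 * CARD('n) * \<delta>" by simp
  qed
  have ind: "integrable lborel (\<lambda>z. b * indicator S z)" if "S \<in> fmeasurable lborel" for S :: "(real^'n) set"
    using that by (simp add: fmeasurable_def)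
  have mQ': "measure lborel ?Q' = measure lborel ?Q"
    using \<delta> by (simp add: measure_cube)
  define s where "s = measure lborel (?Q \<inter> ?Q')"
  have s: "s = (1 - h / (2 * \<delta>)) * measure lborel ?Q"
    using measure_cube_Int_translate[of h \<delta> y j] h \<delta> by (simp add: s_def e_def)
  have "measure lborel (?Q - ?Q \<inter> ?Q') = measure lborel ?Q - s"
    unfolding s_def by (rule measurable_measure_Diff[OF fm]) auto
  moreover have "measure lborel (?Q' - ?Q \<inter> ?Q') = measure lborel ?Q' - s"
    unfolding s_def by (rule measurable_measure_Diff[OF fm]) auto
  moreover have "?Q - ?Q \<inter> ?Q' = ?Q - ?Q'" "?Q' - ?Q \<inter> ?Q' = ?Q' - ?Q" by blast+
  ultimately have diff: "measure lborel (?Q - ?Q') = measure lborel ?Q - s" "measure lborel (?Q' - ?Q) = measure lborel ?Q - s"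
    by (simp_all only: mQ')
  have "\<bar>\<integral>z. indicator ?Q' z * \<phi> z - indicator ?Q z * \<phi> z \<partial>lborel\<bar> \<le>
      (\<integral>z. b * indicator (?Q' - ?Q) z + b * indicator (?Q - ?Q') z \<partial>lborel)"
  proof (rule order_trans[OF integral_abs_bound integral_mono])
    show "integrable lborel (\<lambda>z. \<bar>indicator ?Q' z * \<phi> z - indicator ?Q z * \<phi> z\<bar>)"
      using int by auto
    show "integrable lborel (\<lambda>z. b * indicator (?Q' - ?Q) z + b * indicator (?Q - ?Q') z)"
      by (intro Bochner_Integration.integrable_add ind fmeasurable.Diff fm)
    show "\<bar>indicator ?Q' z * \<phi> z - indicator ?Q z * \<phi> z\<bar> \<le> b * indicator (?Q' - ?Q) z + b * indicator (?Q - ?Q') z" for z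
      using near[of z] by (auto simp: indicator_def)
  qed
  also have "\<dots> = b * (measure lborel ?Q - s) + b * (measure lborel ?Q - s)"
    using ind[OF fmeasurable.Diff[OF fm fm]] by (subst Bochner_Integration.integral_add) (simp_all add: diff)
  \<comment> \<open>Each of the two set differences fills the fraction
    \<open>h / (2 * \<delta>)\<close> of a cube. The factor \<open>h\<close> will cancel against the
    denominator of the difference quotient.\<close>
  also have "\<dots> = h * (b / \<delta> * measure lborel ?Q)"
    using \<delta> by (simp add: s field_simps)
  finally have le: "\<bar>\<integral>z. indicator ?Q' z * \<phi> z - indicator ?Q z * \<phi> z \<partial>lborel\<bar> \<le> h * (b / \<delta> * measure lborel ?Q)" .
  have "(\<integral>z. indicator ?Q z * ((\<phi> (z + e) - \<phi> z) / h) \<partial>lborel) =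
      (\<integral>z. (indicator ?Q z * \<phi> (z + e) - indicator ?Q z * \<phi> z) / h \<partial>lborel)"
    by (simp add: right_diff_distrib)
  also have "\<dots> = (\<integral>z. indicator ?Q' z * \<phi> z - indicator ?Q z * \<phi> z \<partial>lborel) / h"
    using int int_e by (simp add: trans)
  finally show ?thesis
    using le h(1) by (simp add: e_def abs_divide pos_divide_le_eq mult.commute)
qed

text \<open>
  This holds at every point of differentiability, and the means on the left do not see null sets.
\<close>
lemma derivative_cube_mean:
  fixes f :: "real^'n \<Rightarrow> real"
  assumes f: "L-lipschitz_on UNIV f" and D: "(f has_derivative D) (at y)"
    and g: "g \<in> borel_measurable borel"
    and lim: "AE z in lborel. (\<lambda>k. (f (z + (1 / Suc k) *\<^sub>R axis j 1) - f z) / (1 / Suc k)) \<longlonglongrightarrow> g z"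
    and e: "0 < \<epsilon>"
  shows "\<exists>\<eta>>0. \<forall>\<delta>. 0 < \<delta> \<and> \<delta> < \<eta> \<longrightarrow>
    \<bar>(\<integral>z. indicator (cube y \<delta>) z * g z \<partial>lborel) / measure lborel (cube y \<delta>) - D (axis j 1)\<bar> \<le> \<epsilon>"
proof -
  have lin: "linear D" using D by (rule has_derivative_linear)
  have contf: "continuous_on UNIV f" by (rule lipschitz_on_continuous_on[OF f])
  have contD: "continuous_on UNIV D" by (rule linear_continuous_on) (use D in \<open>rule has_derivative_bounded_linear\<close>)
  define n where "n = real CARD('n)"
  have n: "0 < n" by (simp add: n_def)
  \<comment> \<open>Its difference quotients along axis \<open>j\<close> are those of
    \<open>f\<close> minus the constant \<open>D (axis j 1)\<close>, so a bound on their mean is the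
    bound sought.\<close>
  define \<phi> where "\<phi> z = f z - f y - D (z - y)" for z
  have cont\<phi>: "continuous_on UNIV \<phi>"
    unfolding \<phi>_def by (intro continuous_intros contf continuous_on_compose2[OF contD]) auto
  have "0 < \<epsilon> / (2 * n)" using e n by simp
  then obtain d where d: "0 < d" "\<And>z. norm (z - y) < d \<Longrightarrow> \<bar>\<phi> z\<bar> \<le> \<epsilon> / (2 * n) * norm (z - y)"
    using D unfolding has_derivative_at_alt \<phi>_def real_norm_def by blast
  show ?thesis
  proof (intro exI[of _ "d / (2 * n)"] conjI allI impI)
    show "0 < d / (2 * n)" using d n by simp
    fix \<delta> assume "0 < \<delta> \<and> \<delta> < d / (2 * n)"
    then have \<delta>: "0 < \<delta>" "2 * n * \<delta> < d" using n by (auto simp: field_simps)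
    let ?Q = "cube y \<delta>"
    have [measurable]: "?Q \<in> sets borel" by (simp add: cube_def)
    have fm: "?Q \<in> fmeasurable lborel" by (simp add: cube_def)
    have mQ: "0 < measure lborel ?Q" using \<delta> by (simp add: measure_cube)
    \<comment> \<open>The tolerance \<open>\<epsilon> / (2 * n)\<close> in the choice of
      \<open>d\<close> compensates for the radius \<open>2 * n * \<delta>\<close>. The bound
      \<open>b / \<delta>\<close> of the preceding lemma then becomes exactly
      \<open>\<epsilon>\<close>, uniformly in the step of the quotient.\<close>
    have b: "\<bar>\<phi> z\<bar> \<le> \<epsilon> * \<delta>" if "norm (z - y) \<le> 2 * CARD('n) * \<delta>" for z
    proof -
      have z: "norm (z - y) \<le> 2 * n * \<delta>" using that by (simp add: n_def)
      have "\<bar>\<phi> z\<bar> \<le> \<epsilon> / (2 * n) * norm (z - y)" using z \<delta> by (intro d) linarith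
      also have "\<dots> \<le> \<epsilon> / (2 * n) * (2 * n * \<delta>)" using z e n by (intro mult_left_mono) auto
      also have "\<dots> = \<epsilon> * \<delta>" using n by simp
      finally show ?thesis .
    qed
    define q where "q k z = (f (z + (1 / real (Suc k)) *\<^sub>R axis j 1) - f z) / (1 / Suc k)" for k z
    have q_bound: "\<bar>q k z\<bar> \<le> L" for k z
    proof -
      have "\<bar>f (z + (1 / real (Suc k)) *\<^sub>R axis j 1) - f z\<bar> \<le> L * (1 / Suc k)"
        using lipschitz_onD[OF f, of "z + (1 / real (Suc k)) *\<^sub>R axis j 1" z]
        by (simp add: dist_norm norm_axis_1)
      then show ?thesis by (simp only: q_def abs_divide) (simp add: field_simps)
    qed
    have cont_q: "continuous_on UNIV (q k)" for k
      unfolding q_def by (intro continuous_intros contf continuous_on_compose2[OF contf]) auto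
    have int_q: "integrable lborel (\<lambda>z. indicator ?Q z * q k z)" for k
      by (rule integrable_indicator_continuous[OF cont_q]) (simp add: cube_def)
    have lim_int: "(\<lambda>k. \<integral>z. indicator ?Q z * q k z \<partial>lborel) \<longlonglongrightarrow> (\<integral>z. indicator ?Q z * g z \<partial>lborel)"
    proof (rule integral_dominated_convergence[where w = "\<lambda>z. L * indicator ?Q z"])
      show "(\<lambda>z. indicator ?Q z * g z) \<in> borel_measurable lborel" using g by measurable
      show "(\<lambda>z. indicator ?Q z * q k z) \<in> borel_measurable lborel" for k
        using int_q[of k] by (rule borel_measurable_integrable)
      show "integrable lborel (\<lambda>z. L * indicator ?Q z)" using fm by (simp add: fmeasurable_def)
      show "AE z in lborel. (\<lambda>k. indicator ?Q z * q k z) \<longlonglongrightarrow> indicator ?Q z * g z"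
        using lim by eventually_elim (auto simp: q_def intro!: tendsto_intros)
      show "AE z in lborel. norm (indicator ?Q z * q k z) \<le> L * indicator ?Q z" for k
        using q_bound by (auto simp: indicator_def)
    qed
    have mean_q: "\<bar>(\<integral>z. indicator ?Q z * q k z \<partial>lborel) - D (axis j 1) * measure lborel ?Q\<bar> \<le> \<epsilon> * measure lborel ?Q"
      if k: "1 / real (Suc k) \<le> \<delta>" for k
    proof -
      define h where "h = 1 / real (Suc k)"
      have h: "0 < h" "h \<le> \<delta>" using k by (auto simp: h_def)
      have "q k z - D (axis j 1) = (\<phi> (z + h *\<^sub>R axis j 1) - \<phi> z) / h" for z
      proof -
        have "D (z + h *\<^sub>R axis j 1 - y) = D (z - y) + h * D (axis j 1)"
          using linear_add[OF lin, of "z - y" "h *\<^sub>R axis j 1"] linear_scale[OF lin, of h "axis j 1"]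
          by (simp add: algebra_simps)
        then have "\<phi> (z + h *\<^sub>R axis j 1) - \<phi> z = f (z + h *\<^sub>R axis j 1) - f z - h * D (axis j 1)"
          by (simp add: \<phi>_def)
        moreover have "q k z = (f (z + h *\<^sub>R axis j 1) - f z) / h" by (simp only: q_def h_def)
        ultimately show ?thesis using h(1) by (simp add: diff_divide_distrib)
      qed
      then have "(\<integral>z. indicator ?Q z * ((\<phi> (z + h *\<^sub>R axis j 1) - \<phi> z) / h) \<partial>lborel) =
          (\<integral>z. indicator ?Q z * q k z - D (axis j 1) * indicator ?Q z \<partial>lborel)"
        by (intro Bochner_Integration.integral_cong refl) (simp add: algebra_simps flip: right_diff_distrib)
      also have "\<dots> = (\<integral>z. indicator ?Q z * q k z \<partial>lborel) - D (axis j 1) * measure lborel ?Q"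
        using int_q[of k] fm by (simp add: fmeasurable_def)
      finally show ?thesis
        using difference_quotient_mean_le[where j = j and y = y, OF cont\<phi> h b] \<delta>(1) by simp
    qed
    have "\<forall>\<^sub>F k in sequentially. 1 / real (Suc k) \<le> \<delta>"
      using order_tendstoD(2)[OF LIMSEQ_inverse_real_of_nat \<delta>(1)]
      by eventually_elim (simp add: inverse_eq_divide)
    then have "\<forall>\<^sub>F k in sequentially. \<bar>(\<integral>z. indicator ?Q z * q k z \<partial>lborel) - D (axis j 1) * measure lborel ?Q\<bar> \<le> \<epsilon> * measure lborel ?Q"
      by eventually_elim (rule mean_q)
    then have "\<bar>(\<integral>z. indicator ?Q z * g z \<partial>lborel) - D (axis j 1) * measure lborel ?Q\<bar> \<le> \<epsilon> * measure lborel ?Q"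
      by (intro tendsto_upperbound[OF tendsto_rabs[OF tendsto_diff[OF lim_int tendsto_const]]]) auto
    moreover have "(\<integral>z. indicator ?Q z * g z \<partial>lborel) / measure lborel ?Q - D (axis j 1) =
       ((\<integral>z. indicator ?Q z * g z \<partial>lborel) - D (axis j 1) * measure lborel ?Q) / measure lborel ?Q"
      using mQ by (simp add: field_simps)
    ultimately show "\<bar>(\<integral>z. indicator ?Q z * g z \<partial>lborel) / measure lborel ?Q - D (axis j 1)\<bar> \<le> \<epsilon>"
      using mQ by (simp add: abs_divide pos_divide_le_eq)
  qed
qed

lemma jacobian_component_quotient:
  fixes F :: "real^'n \<Rightarrow> real^'m"
  assumes D: "F differentiable (at z)"
  shows "(\<lambda>k. (F (z + (1 / Suc k) *\<^sub>R axis j 1) $ i - F z $ i) / (1 / Suc k)) \<longlonglongrightarrow> jacobian F (at z) $ i $ j"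
proof -
  have F: "(F has_derivative frechet_derivative F (at z)) (at z)" using D by (simp add: frechet_derivative_works)
  define D where "D = frechet_derivative F (at z)"
  have lin: "linear D" unfolding D_def by (rule has_derivative_linear[OF F])
  have "((\<lambda>t. F (z + t *\<^sub>R axis j 1) $ i) has_derivative (\<lambda>t. D (t *\<^sub>R axis j 1) $ i)) (at 0)"
    by (rule bounded_linear.has_derivative[OF bounded_linear_vec_nth],
        rule has_derivative_compose[of "\<lambda>t. z + t *\<^sub>R axis j 1" _ 0 UNIV F D])
      (auto intro!: derivative_eq_intros simp: D_def F)
  moreover have "(\<lambda>t. D (t *\<^sub>R axis j 1) $ i) = (*) (D (axis j 1) $ i)"
    by (rule ext) (simp add: linear_scale[OF lin])
  ultimately have "((\<lambda>t. F (z + t *\<^sub>R axis j 1) $ i) has_field_derivative D (axis j 1) $ i) (at 0)"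
    unfolding has_field_derivative_def by (simp only:)
  then have "((\<lambda>h. (F (z + h *\<^sub>R axis j 1) $ i - F z $ i) / h) \<longlongrightarrow> D (axis j 1) $ i) (at 0)"
    by (simp add: DERIV_def)
  moreover have "filterlim (\<lambda>k. 1 / real (Suc k)) (at 0) sequentially"
    using LIMSEQ_inverse_real_of_nat by (simp add: filterlim_at inverse_eq_divide del: of_nat_Suc)
  ultimately have "(\<lambda>k. (F (z + (1 / Suc k) *\<^sub>R axis j 1) $ i - F z $ i) / (1 / Suc k)) \<longlonglongrightarrow> D (axis j 1) $ i"
    by (rule filterlim_compose)
  moreover have "jacobian F (at z) $ i $ j = D (axis j 1) $ i"
    by (simp add: jacobian_def matrix_def D_def)
  ultimately show ?thesis by simp
qed

section \<open>The generalized derivative\<close>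

text \<open>\<open>G\<close> is a bounded Borel version of the Jacobian near \<open>x\<close>.\<close>
locale jacobian_near =
  fixes \<Omega> :: "(real^'n) set" and F :: "real^'n \<Rightarrow> real^'m" and x :: "real^'n"
    and r L :: real and G :: "'m \<Rightarrow> 'n \<Rightarrow> real^'n \<Rightarrow> real"
  assumes open_\<Omega>: "open \<Omega>"
    and r: "0 < r" "ball x r \<subseteq> \<Omega>"
    and G_borel: "G i j \<in> borel_measurable borel"
    and G_bound: "\<bar>G i j z\<bar> \<le> L"
    and nondiff: "negligible (ball x r - diff_points \<Omega> F)"
    and G: "z \<in> ball x r \<inter> diff_points \<Omega> F \<Longrightarrow> jacobian F (at z) $ i $ j = G i j z"
    and mean: "z \<in> ball x r \<inter> diff_points \<Omega> F \<Longrightarrow> 0 < \<epsilon> \<Longrightarrow> \<forall>\<^sub>F \<delta> in at_right 0. \<forall>i j.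
      \<bar>(\<integral>y. indicator (cube z \<delta>) y * G i j y \<partial>lborel) / measure lborel (cube z \<delta>) - jacobian F (at z) $ i $ j\<bar> \<le> \<epsilon>"

lemma locally_lipschitz_jacobian_near:
  fixes F :: "real^'n \<Rightarrow> real^'m"
  assumes \<Omega>: "open \<Omega>" and F: "locally_lipschitz_on \<Omega> F" and x: "x \<in> \<Omega>"
  obtains r L G where "jacobian_near \<Omega> F x r L G"
proof -
  obtain r0 L where r0: "0 < r0" "L-lipschitz_on (ball x r0 \<inter> \<Omega>) F"
    using F x by (auto simp: locally_lipschitz_on_def)
  obtain r1 where r1: "0 < r1" "ball x r1 \<subseteq> \<Omega>" using \<Omega> x openE by blast
  define r where "r = min r0 r1 / 2"
  have r: "0 < r" "cball x r \<subseteq> ball x r0 \<inter> \<Omega>"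
    using r0(1) r1 by (auto simp: r_def intro!: subsetD[OF r1(2)])
  have L: "0 \<le> L" by (rule lipschitz_on_nonneg[OF r0(2)])
  \<comment> \<open>Projection onto a convex set does not increase distances, so \<open>H\<close> is
    globally Lipschitz with the same constant. It agrees with \<open>F\<close> on an open ball and
    hence has the same derivatives there.\<close>
  define H where "H z = F (closest_point (cball x r) z)" for z
  have cb: "convex (cball x r)" "closed (cball x r)" "cball x r \<noteq> {}" using r(1) by auto
  have H: "L-lipschitz_on UNIV H"
  proof (rule lipschitz_onI[OF _ L])
    fix y z :: "real^'n"
    have "dist (H y) (H z) \<le> L * dist (closest_point (cball x r) y) (closest_point (cball x r) z)"
      unfolding H_def using closest_point_in_set[OF cb(2,3)] r(2) by (intro lipschitz_onD[OF r0(2)]) blast+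
    also have "\<dots> \<le> L * dist y z" by (intro mult_left_mono closest_point_lipschitz cb L)
    finally show "dist (H y) (H z) \<le> L * dist y z" .
  qed
  have HF: "H z = F z" if "z \<in> ball x r" for z using that by (simp add: H_def closest_point_self)
  have deriv_eq: "(F has_derivative f') (at z) \<longleftrightarrow> (H has_derivative f') (at z)" if "z \<in> ball x r" for z f'
    using has_derivative_transform_within_open[of F f' z UNIV "ball x r" H]
      has_derivative_transform_within_open[of H f' z UNIV "ball x r" F] that HF by auto
  have diff_eq: "F differentiable (at z) \<longleftrightarrow> H differentiable (at z)" "jacobian F (at z) = jacobian H (at z)"
    if "z \<in> ball x r" for z
    by (simp_all add: differentiable_def jacobian_def frechet_derivative_def deriv_eq[OF that])
  have D: "z \<in> diff_points \<Omega> F \<longleftrightarrow> H differentiable (at z)" if "z \<in> ball x r" for z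
    using that r(2) diff_eq(1)[OF that] by (auto simp: diff_points_def)
  define q where "q i j k z = (H (z + (1 / real (Suc k)) *\<^sub>R axis j 1) $ i - H z $ i) / (1 / Suc k)"
    for i j k z
  \<comment> \<open>Limits of difference quotients are Borel functions. The clamping keeps
    \<open>G\<close> bounded where the quotients diverge and \<open>lim\<close> is unspecified, and
    does not alter the true partial derivatives.\<close>
  define G where "G i j z = max (- L) (min L (lim (\<lambda>k. q i j k z)))" for i j z
  have contH: "continuous_on UNIV H" by (rule lipschitz_on_continuous_on[OF H])
  have Hi: "L-lipschitz_on UNIV (\<lambda>z. H z $ i)" for i
  proof (rule lipschitz_onI[OF _ L])
    show "dist (H y $ i) (H z $ i) \<le> L * dist y z" for y z
      using lipschitz_onD[OF H, of y z] dist_vec_nth_le[of "H y" i "H z"] by simp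
  qed
  have q_borel: "q i j k \<in> borel_measurable borel" for i j k
    unfolding q_def
    by (intro borel_measurable_continuous_onI continuous_intros continuous_on_compose2[OF contH]) auto
  have q_bound: "\<bar>q i j k z\<bar> \<le> L" for i j k z
  proof -
    have "\<bar>H (z + (1 / real (Suc k)) *\<^sub>R axis j 1) $ i - H z $ i\<bar> \<le> L * (1 / Suc k)"
      using lipschitz_onD[OF Hi, of "z + (1 / real (Suc k)) *\<^sub>R axis j 1" z i]
      by (simp add: dist_norm norm_axis_1)
    then show ?thesis by (simp only: q_def abs_divide) (simp add: field_simps)
  qed
  have q_lim: "(\<lambda>k. q i j k z) \<longlonglongrightarrow> jacobian H (at z) $ i $ j" if "H differentiable (at z)" for i j z
    unfolding q_def by (rule jacobian_component_quotient[OF that])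
  have GH: "jacobian H (at z) $ i $ j = G i j z" if "H differentiable (at z)" for i j z
  proof -
    have "\<bar>jacobian H (at z) $ i $ j\<bar> \<le> L"
      by (rule tendsto_upperbound[OF tendsto_rabs[OF q_lim[OF that]]]) (simp_all add: q_bound)
    then show ?thesis using limI[OF q_lim[OF that]] by (simp add: G_def abs_le_iff min_def max_def)
  qed
  have G_borel: "G i j \<in> borel_measurable borel" for i j
    unfolding G_def using q_borel[of i j] by measurable
  have rad: "negligible {z. \<not> H differentiable (at z)}" by (rule rademacher[OF H])
  have q_lim_ae: "AE z in lborel. (\<lambda>k. q i j k z) \<longlonglongrightarrow> G i j z" for i j
  proof -
    have "AE z in lebesgue. z \<notin> {z. \<not> H differentiable (at z)}"
      using rad by (intro AE_not_in) (simp add: negligible_iff_null_sets)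
    then have "AE z in lebesgue. (\<lambda>k. q i j k z) \<longlonglongrightarrow> G i j z"
      by eventually_elim (use q_lim GH in auto)
    then show ?thesis by (simp add: AE_completion_iff)
  qed
  have "jacobian_near \<Omega> F x r L G"
  proof
    show "\<bar>G i j z\<bar> \<le> L" for i j z using L by (simp add: G_def)
    show "ball x r \<subseteq> \<Omega>" using r(2) by auto
    show "negligible (ball x r - diff_points \<Omega> F)"
      by (rule negligible_subset[OF rad]) (use D in auto)
    show "jacobian F (at z) $ i $ j = G i j z" if "z \<in> ball x r \<inter> diff_points \<Omega> F" for z i j
      using that D diff_eq GH by auto
    show "\<forall>\<^sub>F \<delta> in at_right 0. \<forall>i j.
      \<bar>(\<integral>y. indicator (cube z \<delta>) y * G i j y \<partial>lborel) / measure lborel (cube z \<delta>) - jacobian F (at z) $ i $ j\<bar> \<le> \<epsilon>"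
      if z: "z \<in> ball x r \<inter> diff_points \<Omega> F" and e: "0 < \<epsilon>" for z \<epsilon>
    proof (intro eventually_all_finite)
      fix i j
      have Hz: "H differentiable (at z)" using z D by auto
      then have "(H has_derivative frechet_derivative H (at z)) (at z)" by (simp add: frechet_derivative_works)
      then have "((\<lambda>y. H y $ i) has_derivative (\<lambda>v. frechet_derivative H (at z) v $ i)) (at z)"
        by (rule bounded_linear.has_derivative[OF bounded_linear_vec_nth])
      note mean = derivative_cube_mean[OF Hi this G_borel q_lim_ae[unfolded q_def] e, of j]
      have "jacobian F (at z) = jacobian H (at z)" using z by (intro diff_eq) auto
      then have "jacobian F (at z) $ i $ j = frechet_derivative H (at z) (axis j 1) $ i"
        by (simp only: jacobian_def[of H] matrix_def vec_lambda_beta)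
      with mean
      show "\<forall>\<^sub>F \<delta> in at_right 0.
        \<bar>(\<integral>y. indicator (cube z \<delta>) y * G i j y \<partial>lborel) / measure lborel (cube z \<delta>) - jacobian F (at z) $ i $ j\<bar> \<le> \<epsilon>"
        unfolding eventually_at_right_field by auto
    qed
  qed (use \<Omega> r G_borel in auto)
  then show thesis by (rule that)
qed

lemma norm_matrix_le_sum: "norm (A :: real^'n^'m) \<le> (\<Sum>i\<in>UNIV. \<Sum>j\<in>UNIV. \<bar>A $ i $ j\<bar>)"
proof -
  have "norm A \<le> (\<Sum>i\<in>UNIV. norm (A $ i))" unfolding norm_vec_def by (rule L2_set_le_sum) simp
  also have "\<dots> \<le> (\<Sum>i\<in>UNIV. \<Sum>j\<in>UNIV. \<bar>A $ i $ j\<bar>)" by (intro sum_mono norm_le_l1_cart)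
  finally show ?thesis .
qed

lemma gen_derivativeI:
  assumes "\<mu> \<in> Dens \<Omega> x" "\<And>i j. dens_integral \<Omega> x \<mu> (\<lambda>y. jacobian F (at y) $ i $ j) = A $ i $ j"
  shows "A \<in> gen_derivative \<Omega> F x"
proof -
  have "A = (\<chi> i j. dens_integral \<Omega> x \<mu> (\<lambda>y. jacobian F (at y) $ i $ j))"
    by (simp add: vec_eq_iff assms(2))
  with assms(1) show ?thesis unfolding gen_derivative_def by blast
qed

section \<open>Limits of Jacobians and the two inclusions\<close>

context jacobian_near
begin

definition limit_jacobians :: "(real^'n) set \<Rightarrow> (real^'n^'m) set" where
  "limit_jacobians N = {A. \<exists>xs. (\<forall>j::nat. xs j \<in> diff_points \<Omega> F - N) \<and>
     xs \<longlonglongrightarrow> x \<and> (\<lambda>j. jacobian F (at (xs j))) \<longlonglongrightarrow> A}"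

lemma x_in: "x \<in> \<Omega>"
  using r by auto

lemma ball_borel_subsets: "\<delta> \<le> r \<Longrightarrow> ball x \<delta> \<in> borel_subsets \<Omega>"
  using r(2) subset_ball[of \<delta> r x] by (auto simp: borel_subsets_def)

lemma norm_jacobian_le:
  assumes "z \<in> ball x r \<inter> diff_points \<Omega> F"
  shows "norm (jacobian F (at z)) \<le> CARD('m) * (CARD('n) * L)"
proof -
  have "(\<Sum>i\<in>UNIV. \<Sum>j\<in>UNIV. \<bar>jacobian F (at z) $ i $ j\<bar>) \<le> (\<Sum>i\<in>(UNIV :: 'm set). \<Sum>j\<in>(UNIV :: 'n set). L)"
    using G[OF assms] G_bound by (intro sum_mono) simp
  with norm_matrix_le_sum[of "jacobian F (at z)"] show ?thesis by simp
qed

lemma has_ba_integral_jacobian: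
  assumes \<mu>: "\<mu> \<in> Dens \<Omega> x" and \<delta>: "0 < \<delta>" "\<delta> \<le> r"
  shows "has_ba_integral \<mu> (ball x \<delta>) (\<lambda>y. jacobian F (at y) $ i $ j)
    (dens_integral \<Omega> x \<mu> (\<lambda>y. jacobian F (at y) $ i $ j))"
proof -
  interpret null_additive \<Omega> \<mu> by (rule Dens_null_additive[OF \<mu>])
  have Z: "ball x r - diff_points \<Omega> F \<in> null_sets lebesgue"
    using nondiff by (simp add: negligible_iff_null_sets)
  have "jacobian F (at y) $ i $ j = G i j y" if "y \<in> ball x \<delta> - (ball x r - diff_points \<Omega> F)" for y
    using that \<delta>(2) by (intro G) auto
  from has_ba_integral_exists[OF G_borel G_bound ball_borel_subsets[OF \<delta>(2)] Z this]
  obtain I where I: "has_ba_integral \<mu> (ball x \<delta>) (\<lambda>y. jacobian F (at y) $ i $ j) I" by blast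
  moreover have "ball x \<delta> \<subseteq> \<Omega>" using ball_borel_subsets[OF \<delta>(2)] by (simp add: borel_subsets_def)
  ultimately show ?thesis using dens_integral_eq[OF \<mu> \<delta>(1)] by simp
qed

text \<open>The compactness argument behind closedness, nonemptiness and separation alike. The
  radius is capped by \<open>r\<close> because the Jacobians are bounded only on that ball.\<close>

lemma limit_jacobians_subsequence:
  assumes y: "\<And>k. y k \<in> diff_points \<Omega> F - N" "\<And>k. y k \<in> ball x (min r (1 / Suc k))"
  obtains A s where "A \<in> limit_jacobians N" "strict_mono (s :: nat \<Rightarrow> nat)" "(\<lambda>k. jacobian F (at (y (s k)))) \<longlonglongrightarrow> A"
proof -
  have "bounded (range (\<lambda>k. jacobian F (at (y k))))"
    unfolding bounded_iff using y by (intro exI[of _ "CARD('m) * (CARD('n) * L)"]) (auto intro!: norm_jacobian_le)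
  then obtain A s where s: "strict_mono (s :: nat \<Rightarrow> nat)" "((\<lambda>k. jacobian F (at (y k))) \<circ> s) \<longlonglongrightarrow> A"
    using bounded_imp_convergent_subsequence by blast
  have "y \<longlonglongrightarrow> x"
  proof (rule LIMSEQ_I)
    fix e :: real assume "0 < e"
    then obtain N where N: "1 / real (Suc N) < e" using nat_approx_posE by blast
    have "norm (y k - x) < e" if "N \<le> k" for k
    proof -
      have "1 / real (Suc k) \<le> 1 / Suc N" using that by (simp add: field_simps)
      then show ?thesis using y(2)[of k] N by (simp add: dist_norm norm_minus_commute)
    qed
    then show "\<exists>N. \<forall>k\<ge>N. norm (y k - x) < e" by blast
  qed
  then have "(y \<circ> s) \<longlonglongrightarrow> x" using s(1) by (rule LIMSEQ_subseq_LIMSEQ)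
  then have "A \<in> limit_jacobians N"
    unfolding limit_jacobians_def using s(2) y(1) by (intro CollectI exI[of _ "y \<circ> s"]) (auto simp: o_def)
  then show thesis using that s by (simp add: o_def)
qed

text \<open>Exhibits the set as an intersection of closed sets. For the inclusion from right to
  left, one point is chosen at each scale \<open>k\<close>; any subsequential limit of the Jacobians
  there must be \<open>A\<close>.\<close>

lemma limit_jacobians_eq:
  "limit_jacobians N = (\<Inter>k::nat. closure ((\<lambda>z. jacobian F (at z)) ` ((diff_points \<Omega> F - N) \<inter> ball x (min r (1 / Suc k)))))"
  (is "_ = (\<Inter>k. closure (?J ` ?S k))")
proof (intro equalityI subsetI)
  fix A assume "A \<in> limit_jacobians N"
  then obtain xs where xs: "\<And>j::nat. xs j \<in> diff_points \<Omega> F - N" "xs \<longlonglongrightarrow> x" "(\<lambda>j. ?J (xs j)) \<longlonglongrightarrow> A"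
    by (auto simp: limit_jacobians_def)
  show "A \<in> (\<Inter>k. closure (?J ` ?S k))"
  proof
    fix k
    have "\<forall>\<^sub>F j in sequentially. xs j \<in> ball x (min r (1 / Suc k))"
      using xs(2) r(1) by (intro topological_tendstoD) auto
    then have "\<forall>\<^sub>F j in sequentially. ?J (xs j) \<in> closure (?J ` ?S k)"
    proof eventually_elim
      case (elim j)
      then have "xs j \<in> ?S k" using xs(1) by simp
      then show ?case by (intro subsetD[OF closure_subset] imageI)
    qed
    then show "A \<in> closure (?J ` ?S k)" by (rule Lim_in_closed_set[OF closed_closure _ _ xs(3)]) simp
  qed
next
  fix A assume A: "A \<in> (\<Inter>k. closure (?J ` ?S k))"
  have "\<exists>z. z \<in> ?S k \<and> dist (?J z) A < 1 / Suc k" for k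
  proof -
    have "A \<in> closure (?J ` ?S k)" using A by blast
    moreover have "0 < 1 / real (Suc k)" by simp
    ultimately obtain X where "X \<in> ?J ` ?S k" "dist X A < 1 / Suc k"
      unfolding closure_approachable by blast
    then show ?thesis by blast
  qed
  then obtain y where y: "\<And>k. y k \<in> ?S k" "\<And>k. dist (?J (y k)) A < 1 / Suc k" by metis
  obtain B s where B: "B \<in> limit_jacobians N" "strict_mono (s :: nat \<Rightarrow> nat)" "(\<lambda>k. ?J (y (s k))) \<longlonglongrightarrow> B"
    using limit_jacobians_subsequence[of y N] y(1) by blast
  have "(\<lambda>k. ?J (y k)) \<longlonglongrightarrow> A"
  proof (rule metric_tendsto_imp_tendsto[OF LIMSEQ_inverse_real_of_nat])
    show "\<forall>\<^sub>F k in sequentially. dist (?J (y k)) A \<le> dist (inverse (real (Suc k))) 0"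
      using y(2) by (intro always_eventually allI less_imp_le) (simp add: inverse_eq_divide)
  qed
  then have "(\<lambda>k. ?J (y (s k))) \<longlonglongrightarrow> A" using LIMSEQ_subseq_LIMSEQ[OF _ B(2)] by (auto simp: o_def)
  with B show "A \<in> limit_jacobians N" using LIMSEQ_unique by blast
qed

text \<open>A ball is not negligible, whereas by Rademacher's theorem the points to be avoided in it
  are.\<close>

lemma diff_points_near:
  assumes "negligible N" "0 < \<delta>"
  obtains z where "z \<in> diff_points \<Omega> F - N" "z \<in> ball x (min r \<delta>)"
proof -
  have "\<not> negligible (ball x (min r \<delta>))" using r(1) assms(2) by (intro open_not_negligible) auto
  moreover have "negligible ((ball x r - diff_points \<Omega> F) \<union> N)" by (rule negligible_Un[OF nondiff assms(1)])
  ultimately have "\<not> ball x (min r \<delta>) \<subseteq> (ball x r - diff_points \<Omega> F) \<union> N" using negligible_subset by blast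
  then obtain z where "z \<in> ball x (min r \<delta>)" "z \<notin> (ball x r - diff_points \<Omega> F) \<union> N" by blast
  then show thesis by (intro that[of z]) auto
qed

lemma limit_jacobians_compact: "compact (limit_jacobians N)"
proof -
  have "limit_jacobians N \<subseteq> closure ((\<lambda>z. jacobian F (at z)) ` ((diff_points \<Omega> F - N) \<inter> ball x (min r (1 / Suc 0))))"
    unfolding limit_jacobians_eq by blast
  moreover have "bounded ((\<lambda>z. jacobian F (at z)) ` ((diff_points \<Omega> F - N) \<inter> ball x (min r (1 / Suc 0))))"
    unfolding bounded_iff by (intro exI[of _ "CARD('m) * (CARD('n) * L)"]) (auto intro!: norm_jacobian_le)
  ultimately have "bounded (limit_jacobians N)" using bounded_closure bounded_subset by blast
  moreover have "closed (limit_jacobians N)" unfolding limit_jacobians_eq by (intro closed_INT) auto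
  ultimately show ?thesis by (simp add: compact_eq_bounded_closed)
qed

lemma limit_jacobians_nonempty:
  assumes "negligible N"
  shows "limit_jacobians N \<noteq> {}"
proof -
  have "\<exists>z. z \<in> diff_points \<Omega> F - N \<and> z \<in> ball x (min r (1 / Suc k))" for k
    using diff_points_near[OF assms, of "1 / Suc k"] by auto
  then obtain y where "\<And>k. y k \<in> diff_points \<Omega> F - N \<and> y k \<in> ball x (min r (1 / Suc k))" by metis
  then show ?thesis using limit_jacobians_subsequence[of y N] by blast
qed

lemma limit_jacobians_subset: "limit_jacobians N \<subseteq> gen_derivative \<Omega> F x"
proof
  fix A assume "A \<in> limit_jacobians N"
  then obtain xs where xs: "\<And>j::nat. xs j \<in> diff_points \<Omega> F" "xs \<longlonglongrightarrow> x" "(\<lambda>j. jacobian F (at (xs j))) \<longlonglongrightarrow> A"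
    by (auto simp: limit_jacobians_def)
  let ?mean = "\<lambda>Q i j. (\<integral>y. indicator Q y * G i j y \<partial>lborel) / measure lborel Q"
  \<comment> \<open>One \<open>1 / Suc k\<close> is spent between the mean over the cube and DF at
    its centre, the other between DF there and \<open>A\<close>.\<close>
  have "\<exists>Q. Q \<in> sets borel \<and> 0 < measure lborel Q \<and> Q \<subseteq> ball x (1 / Suc k) \<and>
      (\<forall>i j. \<bar>?mean Q i j - A $ i $ j\<bar> \<le> 2 / Suc k)" for k
  proof -
    \<comment> \<open>Half of the target radius: the centre of the cube is within
      \<open>\<rho>\<close> of \<open>x\<close>, and the cube within \<open>\<rho>\<close> of its
      centre.\<close>
    define \<rho> where "\<rho> = 1 / real (Suc k) / 2"
    have \<rho>: "0 < \<rho>" by (simp add: \<rho>_def)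
    have "\<forall>\<^sub>F j in sequentially. xs j \<in> ball x (min r \<rho>)"
      using xs(2) r(1) \<rho> by (intro topological_tendstoD) auto
    moreover have "\<forall>\<^sub>F j in sequentially. dist (jacobian F (at (xs j))) A < 1 / Suc k"
      using xs(3) by (intro tendstoD) auto
    ultimately obtain j0 where j0: "xs j0 \<in> ball x (min r \<rho>)" "dist (jacobian F (at (xs j0))) A < 1 / Suc k"
      using eventually_happens[OF eventually_conj] by fastforce
    define y where "y = xs j0"
    have "y \<in> ball x r \<inter> diff_points \<Omega> F" using j0 xs(1) by (simp add: y_def)
    from mean[OF this, of "1 / Suc k"]
    have "\<forall>\<^sub>F \<delta> in at_right 0. \<forall>i j. \<bar>?mean (cube y \<delta>) i j - jacobian F (at y) $ i $ j\<bar> \<le> 1 / Suc k" by simp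
    moreover have "\<forall>\<^sub>F \<delta> in at_right 0. 0 < \<delta> \<and> \<delta> < \<rho> / CARD('n)"
      using \<rho> by (intro eventually_conj eventually_at_right_less order_tendstoD(2)[OF tendsto_ident_at]) auto
    ultimately have "\<forall>\<^sub>F \<delta> in at_right 0. (\<forall>i j. \<bar>?mean (cube y \<delta>) i j - jacobian F (at y) $ i $ j\<bar> \<le> 1 / Suc k) \<and>
        0 < \<delta> \<and> \<delta> < \<rho> / CARD('n)"
      by (rule eventually_conj)
    then obtain \<delta> where \<delta>: "\<And>i j. \<bar>?mean (cube y \<delta>) i j - jacobian F (at y) $ i $ j\<bar> \<le> 1 / Suc k"
        "0 < \<delta>" "\<delta> < \<rho> / CARD('n)"
      using eventually_happens'[OF trivial_limit_at_right_real[of 0]] by blast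
    show ?thesis
    proof (intro exI[of _ "cube y \<delta>"] conjI allI)
      show "cube y \<delta> \<in> sets borel" by (simp add: cube_def)
      show "0 < measure lborel (cube y \<delta>)" using \<delta>(2) by (simp add: measure_cube)
      have "cube y \<delta> \<subseteq> ball y \<rho>" using \<delta>(3) by (intro cube_subset_ball) (simp add: field_simps)
      also have "\<dots> \<subseteq> ball x (1 / Suc k)"
      proof
        fix z assume "z \<in> ball y \<rho>"
        then have "dist x z < \<rho> + \<rho>"
          using j0(1) dist_triangle[of x z y] by (simp add: y_def)
        moreover have "\<rho> + \<rho> = 1 / Suc k" unfolding \<rho>_def by (rule field_sum_of_halves)
        ultimately show "z \<in> ball x (1 / Suc k)" by simp
      qed
      finally show "cube y \<delta> \<subseteq> ball x (1 / Suc k)" .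
      fix i j
      have "\<bar>jacobian F (at y) $ i $ j - A $ i $ j\<bar> \<le> norm ((jacobian F (at y) - A) $ i)"
        using component_le_norm_cart[of "(jacobian F (at y) - A) $ i" j] by simp
      also have "\<dots> \<le> norm (jacobian F (at y) - A)" by (rule Finite_Cartesian_Product.norm_nth_le)
      finally have "\<bar>jacobian F (at y) $ i $ j - A $ i $ j\<bar> \<le> 1 / Suc k"
        using j0(2) by (simp add: y_def dist_norm)
      moreover have "2 / real (Suc k) = 1 / Suc k + 1 / Suc k"
        by (simp add: add_divide_distrib[symmetric] del: of_nat_Suc)
      ultimately show "\<bar>?mean (cube y \<delta>) i j - A $ i $ j\<bar> \<le> 2 / Suc k"
        using \<delta>(1)[of i j] by linarith
    qed
  qed
  then have "\<exists>Q. \<forall>k. Q k \<in> sets borel \<and> 0 < measure lborel (Q k) \<and> Q k \<subseteq> ball x (1 / Suc k) \<and>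
      (\<forall>i j. \<bar>?mean (Q k) i j - A $ i $ j\<bar> \<le> 2 / Suc k)"
    by (intro choice allI)
  then obtain Q where Q: "\<And>k. Q k \<in> sets borel" "\<And>k. 0 < measure lborel (Q k)" "\<And>k. Q k \<subseteq> ball x (1 / Suc k)"
      "\<And>k i j. \<bar>?mean (Q k) i j - A $ i $ j\<bar> \<le> 2 / Suc k"
    by blast
  have lim: "(\<lambda>k. ?mean (Q k) i j) \<longlonglongrightarrow> A $ i $ j" for i j
  proof (rule metric_tendsto_imp_tendsto[OF tendsto_mult_right_zero[OF LIMSEQ_inverse_real_of_nat, of 2]])
    show "\<forall>\<^sub>F k in sequentially. dist (?mean (Q k) i j) (A $ i $ j) \<le> dist (2 * inverse (real (Suc k))) 0"
      using Q(4) by (intro always_eventually allI) (simp add: dist_real_def divide_inverse abs_mult)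
  qed
  have Z: "ball x r - diff_points \<Omega> F \<in> null_sets lebesgue"
    using nondiff by (simp add: negligible_iff_null_sets)
  obtain \<mu> where \<mu>: "\<mu> \<in> Dens \<Omega> x"
    "\<And>i j. has_ba_integral \<mu> (ball x r) (\<lambda>y. jacobian F (at y) $ i $ j) (A $ i $ j)"
  proof (rule Dens_of_means[OF open_\<Omega> x_in Q(1-3)])
    fix \<mu> assume \<mu>: "\<mu> \<in> Dens \<Omega> x"
      "\<And>r f g M a Z. 0 < r \<Longrightarrow> ball x r \<subseteq> \<Omega> \<Longrightarrow> g \<in> borel_measurable borel \<Longrightarrow> (\<And>y. \<bar>g y\<bar> \<le> M) \<Longrightarrow>
       Z \<in> null_sets lebesgue \<Longrightarrow> (\<And>y. y \<in> ball x r - Z \<Longrightarrow> f y = g y) \<Longrightarrow>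
       (\<lambda>k. (\<integral>y. indicator (Q k) y * g y \<partial>lborel) / measure lborel (Q k)) \<longlonglongrightarrow> a \<Longrightarrow>
       has_ba_integral \<mu> (ball x r) f a"
    have "has_ba_integral \<mu> (ball x r) (\<lambda>y. jacobian F (at y) $ i $ j) (A $ i $ j)" for i j
      by (rule \<mu>(2)[OF r G_borel G_bound Z G lim]) auto
    with \<mu>(1) show thesis by (rule that)
  qed
  show "A \<in> gen_derivative \<Omega> F x"
    by (rule gen_derivativeI[OF \<mu>(1) dens_integral_eq[OF \<mu>(1) r \<mu>(2)]])
qed

lemma gen_derivative_convex: "convex (gen_derivative \<Omega> F x)"
proof (rule convexI)
  fix A B and u v :: real
  assume "A \<in> gen_derivative \<Omega> F x" "B \<in> gen_derivative \<Omega> F x" and uv: "0 \<le> u" "0 \<le> v" "u + v = 1"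
  then obtain \<mu> \<nu> where \<mu>: "\<mu> \<in> Dens \<Omega> x" "A = (\<chi> i j. dens_integral \<Omega> x \<mu> (\<lambda>y. jacobian F (at y) $ i $ j))"
    and \<nu>: "\<nu> \<in> Dens \<Omega> x" "B = (\<chi> i j. dens_integral \<Omega> x \<nu> (\<lambda>y. jacobian F (at y) $ i $ j))"
    unfolding gen_derivative_def by blast
  define \<rho> where "\<rho> E = u * \<mu> E + v * \<nu> E" for E
  have \<rho>: "\<rho> \<in> Dens \<Omega> x" unfolding \<rho>_def by (rule Dens_convex_combination[OF \<mu>(1) \<nu>(1) uv])
  have "has_ba_integral \<rho> (ball x r) (\<lambda>y. jacobian F (at y) $ i $ j) (u * A $ i $ j + v * B $ i $ j)" for i j
    unfolding \<rho>_def \<mu>(2) \<nu>(2) vec_lambda_beta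
    by (rule has_ba_integral_convex_combination[OF Dens_null_additive[OF \<mu>(1)] Dens_null_additive[OF \<nu>(1)]
          ball_borel_subsets[OF order_refl] has_ba_integral_jacobian[OF \<mu>(1) r(1) order_refl]
          has_ba_integral_jacobian[OF \<nu>(1) r(1) order_refl]])
  from dens_integral_eq[OF \<rho> r this]
  show "u *\<^sub>R A + v *\<^sub>R B \<in> gen_derivative \<Omega> F x" by (intro gen_derivativeI[OF \<rho>]) simp
qed

lemma gen_derivative_subset:
  assumes N: "negligible N"
  shows "gen_derivative \<Omega> F x \<subseteq> convex hull limit_jacobians N"
proof (rule subsetI, rule ccontr)
  fix A assume "A \<in> gen_derivative \<Omega> F x" and nA: "A \<notin> convex hull limit_jacobians N"
  then obtain \<mu> where \<mu>: "\<mu> \<in> Dens \<Omega> x" and A: "A = (\<chi> i j. dens_integral \<Omega> x \<mu> (\<lambda>y. jacobian F (at y) $ i $ j))"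
    unfolding gen_derivative_def by blast
  interpret null_additive \<Omega> \<mu> by (rule Dens_null_additive[OF \<mu>])
  have "closed (convex hull limit_jacobians N)"
    by (intro compact_imp_closed compact_convex_hull limit_jacobians_compact)
  from separating_hyperplane_closed_point[OF convex_convex_hull this nA]
  obtain V b where V: "V \<bullet> A < b" "\<And>X. X \<in> convex hull limit_jacobians N \<Longrightarrow> b < V \<bullet> X" by blast
  \<comment> \<open>Otherwise points tending to \<open>x\<close> with
    \<open>V \<bullet> DF \<le> b\<close> would yield a limit on the wrong side of the hyperplane,
    where the separation from the hull is strict.\<close>
  have "\<exists>k. \<forall>y\<in>(diff_points \<Omega> F - N) \<inter> ball x (min r (1 / Suc k)). b \<le> V \<bullet> jacobian F (at y)"
  proof (rule ccontr)
    assume "\<not> ?thesis"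
    then have "\<forall>k. \<exists>y. y \<in> diff_points \<Omega> F - N \<and> y \<in> ball x (min r (1 / Suc k)) \<and> V \<bullet> jacobian F (at y) \<le> b"
      by (force simp: not_le)
    then obtain y where y: "\<And>k. y k \<in> diff_points \<Omega> F - N" "\<And>k. y k \<in> ball x (min r (1 / Suc k))"
      "\<And>k. V \<bullet> jacobian F (at (y k)) \<le> b" by metis
    obtain X s where X: "X \<in> limit_jacobians N" "(\<lambda>k. jacobian F (at (y (s k)))) \<longlonglongrightarrow> X"
      using limit_jacobians_subsequence[OF y(1,2)] by blast
    have "V \<bullet> X \<le> b"
      by (rule tendsto_upperbound[OF tendsto_inner[OF tendsto_const X(2)]]) (simp_all add: y(3))
    with V(2)[OF hull_inc[OF X(1)]] show False by simp
  qed
  then obtain k where k: "\<And>y. y \<in> (diff_points \<Omega> F - N) \<inter> ball x (min r (1 / Suc k)) \<Longrightarrow> b \<le> V \<bullet> jacobian F (at y)"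
    by blast
  define \<delta> where "\<delta> = min r (1 / real (Suc k))"
  have \<delta>: "0 < \<delta>" "\<delta> \<le> r" using r(1) by (auto simp: \<delta>_def)
  have inner: "V \<bullet> X = (\<Sum>p\<in>UNIV. V $ fst p $ snd p * X $ fst p $ snd p)" for X :: "real^'n^'m"
    by (simp add: inner_vec_def sum.cartesian_product case_prod_beta UNIV_Times_UNIV)
  \<comment> \<open>The signs are reversed since \<open>has_ba_integral_le\<close> bounds integrals
    from above. Writing the inner product as a finite sum over entries reduces it to the
    componentwise integrals.\<close>
  have "has_ba_integral \<mu> (ball x \<delta>) (\<lambda>y. \<Sum>p\<in>UNIV. (- V $ fst p $ snd p) * jacobian F (at y) $ fst p $ snd p)
      (\<Sum>p\<in>UNIV. (- V $ fst p $ snd p) * A $ fst p $ snd p)"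
    unfolding A vec_lambda_beta
    by (rule has_ba_integral_sum[OF finite has_ba_integral_jacobian[OF \<mu> \<delta>] ball_borel_subsets[OF \<delta>(2)]])
  then have "has_ba_integral \<mu> (ball x \<delta>) (\<lambda>y. - (V \<bullet> jacobian F (at y))) (- (V \<bullet> A))"
    by (simp add: inner sum_negf)
  moreover have "(ball x r - diff_points \<Omega> F) \<union> N \<in> null_sets lebesgue"
    using negligible_Un[OF nondiff N] by (simp add: negligible_iff_null_sets)
  moreover have "- (V \<bullet> jacobian F (at y)) \<le> - b" if "y \<in> ball x \<delta> - ((ball x r - diff_points \<Omega> F) \<union> N)" for y
    using k[of y] that by (auto simp: \<delta>_def)
  ultimately have "- (V \<bullet> A) \<le> - b * \<mu> (ball x \<delta>)"
    by (rule has_ba_integral_le[OF _ ball_borel_subsets[OF \<delta>(2)]])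
  moreover have "ball x \<delta> \<inter> \<Omega> = ball x \<delta>" using ball_borel_subsets[OF \<delta>(2)] by (auto simp: borel_subsets_def)
  then have "\<mu> (ball x \<delta>) = 1" using \<mu> \<delta>(1) unfolding Dens_def by force
  ultimately show False using V(1) by simp
qed

lemma gen_derivative_eq_hull:
  assumes "negligible N"
  shows "gen_derivative \<Omega> F x = convex hull limit_jacobians N"
  by (intro equalityI gen_derivative_subset assms hull_minimal limit_jacobians_subset gen_derivative_convex)

end

section \<open>Support functions\<close>

text \<open>Compactness makes the maximum attained, which is what gives \<open>GREATEST\<close> its
  value. A point outside \<open>C\<close> violates the inequality in the direction of a separating
  hyperplane.\<close>

lemma compact_convex_eq_support_le:
  fixes C :: "'a::euclidean_space set"
  assumes C: "compact C" "convex C" "C \<noteq> {}"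
  shows "C = {A. \<forall>V. A \<bullet> V \<le> (GREATEST t. t \<in> (\<lambda>A. A \<bullet> V) ` C)}"
proof -
  have max: "\<exists>A\<in>C. (GREATEST t. t \<in> (\<lambda>A. A \<bullet> V) ` C) = A \<bullet> V \<and> (\<forall>B\<in>C. B \<bullet> V \<le> A \<bullet> V)" for V
  proof -
    have "continuous_on C (\<lambda>A. A \<bullet> V)" by (intro continuous_intros)
    from continuous_attains_sup[OF C(1,3) this]
    obtain A where A: "A \<in> C" "\<And>B. B \<in> C \<Longrightarrow> B \<bullet> V \<le> A \<bullet> V" by blast
    then have "(GREATEST t. t \<in> (\<lambda>A. A \<bullet> V) ` C) = A \<bullet> V" by (intro Greatest_equality) auto
    with A show ?thesis by blast
  qed
  show ?thesis
  proof (intro equalityI subsetI CollectI allI)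
    fix A V assume "A \<in> C"
    with max[of V] show "A \<bullet> V \<le> (GREATEST t. t \<in> (\<lambda>A. A \<bullet> V) ` C)" by auto
  next
    fix A assume A: "A \<in> {A. \<forall>V. A \<bullet> V \<le> (GREATEST t. t \<in> (\<lambda>A. A \<bullet> V) ` C)}"
    show "A \<in> C"
    proof (rule ccontr)
      assume "A \<notin> C"
      from separating_hyperplane_closed_point[OF C(2) compact_imp_closed[OF C(1)] this]
      obtain V b where V: "V \<bullet> A < b" "\<And>X. X \<in> C \<Longrightarrow> b < V \<bullet> X" by blast
      \<comment> \<open>The hyperplane has \<open>A\<close> on its lower side, so the violated
        direction is \<open>- V\<close>.\<close>
      obtain X where X: "X \<in> C" "(GREATEST t. t \<in> (\<lambda>A. A \<bullet> - V) ` C) = X \<bullet> - V" using max[of "- V"] by blast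
      have "A \<bullet> - V \<le> (GREATEST t. t \<in> (\<lambda>A. A \<bullet> - V) ` C)" using A by blast
      then have "V \<bullet> X \<le> V \<bullet> A" unfolding X(2) by (simp add: inner_commute)
      with V(1) V(2)[OF X(1)] show False by simp
    qed
  qed
qed

theorem theorem5p20:
  fixes \<Omega> N :: "(real^'n) set"
    and F :: "real^'n \<Rightarrow> real^'m"
    and x :: "real^'n"
  assumes "open \<Omega>"
    and "locally_lipschitz_on \<Omega> F"
    and "x \<in> \<Omega>"
    and "N \<subseteq> \<Omega>"
    and "N \<in> null_sets lebesgue"
  shows "gen_derivative \<Omega> F x =
           convex hull {A. \<exists>xs. (\<forall>j::nat. xs j \<in> diff_points \<Omega> F - N) \<and>
             xs \<longlonglongrightarrow> x \<and> (\<lambda>j. jacobian F (at (xs j))) \<longlonglongrightarrow> A} \<and>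
         gen_derivative \<Omega> F x =
           {A. \<forall>V. A \<bullet> V \<le> gen_dir_derivative \<Omega> F x V}"
proof -
  obtain r L G where "jacobian_near \<Omega> F x r L G"
    using locally_lipschitz_jacobian_near[OF assms(1-3)] .
  then interpret jacobian_near \<Omega> F x r L G .
  have N: "negligible N" using assms(5) by (simp add: negligible_iff_null_sets)
  note hull = gen_derivative_eq_hull[OF N]
  have "compact (gen_derivative \<Omega> F x)" "gen_derivative \<Omega> F x \<noteq> {}"
    unfolding hull using limit_jacobians_compact limit_jacobians_nonempty[OF N]
    by (auto intro: compact_convex_hull)
  from compact_convex_eq_support_le[OF this(1) gen_derivative_convex this(2)]
  show ?thesis using hull unfolding limit_jacobians_def gen_dir_derivative_def by blast
qed

end
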